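(* Let $K_1, K_2$ be infinite compact Hausdorff spaces and let $E_1,E_2$ be nonzero Banach spaces with nontrivial cotype. Assume that $K_1$ is perfect (i.e. has no isolated points) and that $\mathcal{C}(K_1,E_1)$ is isomorphic to $\mathcal{C}(K_2,E_2)$. Then $c_{\text{pb}}(K_2^{(\infty)},K_2)=c(K_2)$. Consequently, $c(K_2^{(\infty)})\ge c(K_2)$.
   Context: All topological spaces are Hausdorff. For a compact space $K$ and a Banach space $E$, $\mathcal{C}(K,E)$ is the Banach space of continuous functions $K\to E$ with the sup-norm. Isomorphic means linearly homeomorphic. Cantor-Bendixson derivatives: $X^{(0)}=X$, $X^{(1)}$ is the set of accumulation points of $X$, $X^{(\beta+1)}=(X^{(\beta)})^{(1)}$, and $X^{(\alpha)}=\bigcap_{\beta<\alpha}X^{(\beta)}$ for limit ordinals $\alpha$. The perfect kernel $X^{(\infty)}$ is the eventual value $X^{(\alpha)}$, where $\alpha$ is such that $X^{(\alpha)}=X^{(\beta)}$ for all $\beta>\alpha$. A family $\mathcal{U}$ of nonempty subsets of a topological space $X$ is point-bounded if there is $k\in\mathbb{N}$ such that every $x\in X$ lies in at most $k$ sets from $\mathcal{U}$. The family $\mathcal{U}$ is meeting $A\subseteq X$ if $A\cap U\ne\emptyset$ for each $U\in\mathcal{U}$. For $A\subseteq X$, $c_{\text{pb}}(A,X)$ is the supremum of the cardinalities $|\mathcal{U}|$ over all point-bounded families $\mathcal{U}$ of nonempty open subsets of $X$ that are meeting $A$. The cellularity $c(X)$ is the supremum of the cardinalities of families of pairwise disjoint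 nonempty open subsets of $X$; for a subset $A$ of a space, $c(A)$ is the cellularity of $A$ with the inherited topology. A Banach space $E$ has nontrivial cotype if there are a real number $q\ge 2$ and a constant $C>0$ such that for all $n\in\mathbb{N}$ and $e_1,\dots,e_n\in E$, $\left(\sum_{i=1}^n\|e_i\|^q\right)^{1/q}\le C\left(\int_0^1\left\|\sum_{i=1}^n r_i(t)e_i\right\|^2dt\right)^{1/2}$, where $r_i(t)=\operatorname{sign}(\sin(2^i\pi t))$ are the Rademacher functions. *)

theory Defs
  imports "HOL-Analysis.Analysis"
begin

unbundle cardinal_syntax

section \<open>Suprema of cardinals\<close>

text \<open>Cardinal numbers are the cardinal orders of \<^theory>\<open>HOL.BNF_Cardinal_Order_Relation\<close>, taken
  up to \<open>=o\<close>. Hence the supremum is specified up to \<open>=o\<close> only. The bound \<open>t\<close> ranges over the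
  cardinals on the same type, which is no restriction by \<open>card_Sup_least\<close>.\<close>

definition is_card_Sup :: "'b rel set \<Rightarrow> 'b rel \<Rightarrow> bool" where
  "is_card_Sup R s \<longleftrightarrow>
     Card_order s \<and> (\<forall>r\<in>R. r \<le>o s) \<and>
     (\<forall>t::'b rel. Card_order t \<and> (\<forall>r\<in>R. r \<le>o t) \<longrightarrow> s \<le>o t)"

definition card_Sup :: "'b rel set \<Rightarrow> 'b rel" where
  "card_Sup R = (SOME s. is_card_Sup R s)"

lemma is_card_Sup_card_Sup:
  fixes R :: "'b rel set"
  assumes "\<And>r. r \<in> R \<Longrightarrow> Card_order r"
  shows "is_card_Sup R (card_Sup R)"
proof -
  define B where "B = {t::'b rel. Card_order t \<and> (\<forall>r\<in>R. r \<le>o t)}"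
  have bound: "r \<le>o |UNIV::'b set|" if "r \<in> R" for r
  proof -
    have "|Field r| =o r" using assms that card_of_Field_ordIso by blast
    moreover have "|Field r| \<le>o |UNIV::'b set|" by (rule card_of_mono1) simp
    ultimately show ?thesis using ordIso_ordLeq_trans ordIso_symmetric by blast
  qed
  then have "|UNIV::'b set| \<in> B" by (simp add: B_def card_of_Card_order)
  then have "B \<noteq> {}" by blast
  moreover have "\<forall>t\<in>B. Card_order t" by (simp add: B_def)
  ultimately obtain s where "s \<in> B" "\<forall>t\<in>B. s \<le>o t"
    using exists_minim_Card_order[of B] by blast
  then have "is_card_Sup R s" by (simp add: is_card_Sup_def B_def)
  then show ?thesis unfolding card_Sup_def by (rule someI)
qed

lemma card_Sup_least:
  fixes R :: "'b rel set" and t :: "'c rel"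
  assumes R: "\<And>r. r \<in> R \<Longrightarrow> Card_order r"
    and t: "Card_order t" "\<And>r. r \<in> R \<Longrightarrow> r \<le>o t"
  shows "card_Sup R \<le>o t"
proof (rule ccontr)
  let ?s = "card_Sup R"
  assume not_le: "\<not> ?s \<le>o t"
  have s: "is_card_Sup R ?s" using R by (rule is_card_Sup_card_Sup)
  then have "Well_order ?s" by (auto simp: is_card_Sup_def card_order_on_def)
  moreover have "Well_order t" using t by (simp add: card_order_on_def)
  ultimately have "t <o ?s" using not_le not_ordLeq_iff_ordLess by blast
  then obtain p :: "'b rel" where p: "t =o p" "p <o ?s"
    using internalize_ordLess[of t ?s] by blast
  have "Card_order p" using t(1) p(1) Card_order_ordIso2 by blast
  moreover have "\<forall>r\<in>R. r \<le>o p" using t(2) p(1) ordLeq_ordIso_trans by blast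
  ultimately have "?s \<le>o p" using s by (auto simp: is_card_Sup_def)
  then show False using p(2) not_ordLess_ordLeq by blast
qed


section \<open>Cellularity and point-bounded families\<close>

definition cellularity :: "'a topology \<Rightarrow> 'a set rel" where
  "cellularity X =
     card_Sup {|\<U>| | \<U>. (\<forall>U\<in>\<U>. openin X U \<and> U \<noteq> {}) \<and> pairwise disjnt \<U>}"

definition point_bounded :: "'a topology \<Rightarrow> 'a set set \<Rightarrow> bool" where
  "point_bounded X \<U> \<longleftrightarrow>
     (\<forall>U\<in>\<U>. U \<subseteq> topspace X \<and> U \<noteq> {}) \<and>
     (\<exists>k::nat. \<forall>x\<in>topspace X. finite {U\<in>\<U>. x \<in> U} \<and> card {U\<in>\<U>. x \<in> U} \<le> k)"

definition family_meeting :: "'a set set \<Rightarrow> 'a set \<Rightarrow> bool" where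
  "family_meeting \<U> A \<longleftrightarrow> (\<forall>U\<in>\<U>. A \<inter> U \<noteq> {})"

definition c_pb :: "'a set \<Rightarrow> 'a topology \<Rightarrow> 'a set rel" where
  "c_pb A X =
     card_Sup {|\<U>| | \<U>. (\<forall>U\<in>\<U>. openin X U) \<and> point_bounded X \<U> \<and> family_meeting \<U> A}"


section \<open>Cantor-Bendixson derivatives and the perfect kernel\<close>

definition cb_derive :: "'a topology \<Rightarrow> 'a set \<Rightarrow> 'a set" where
  "cb_derive X S = (subtopology X S) derived_set_of S"

text \<open>Ordinals are the elements of the field of a well-order \<open>r\<close>.
  \<open>ord_pred r \<beta> \<alpha>\<close> says that \<open>\<alpha> = \<beta> + 1\<close>.\<close>

definition ord_pred :: "'o rel \<Rightarrow> 'o \<Rightarrow> 'o \<Rightarrow> bool" where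
  "ord_pred r \<beta> \<alpha> \<longleftrightarrow> \<beta> \<in> underS r \<alpha> \<and> (\<forall>\<gamma>\<in>underS r \<alpha>. (\<gamma>, \<beta>) \<in> r)"

definition cb_derivative :: "'o rel \<Rightarrow> 'a topology \<Rightarrow> 'o \<Rightarrow> 'a set" where
  "cb_derivative r X = wo_rel.worec r (\<lambda>D \<alpha>.
     if underS r \<alpha> = {} then topspace X
     else if \<exists>\<beta>. ord_pred r \<beta> \<alpha> then cb_derive X (D (THE \<beta>. ord_pred r \<beta> \<alpha>))
     else (\<Inter>\<beta>\<in>underS r \<alpha>. D \<beta>))"

text \<open>The ordinals below the initial ordinal of the power set of the underlying type suffice for
  the derivatives to become stationary (\<open>perfect_kernel_eventual\<close>), and derivatives that become
  stationary along any other well-order do so at the same set (\<open>cb_derivative_eq_perfect_kernel\<close>).\<close>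

definition perfect_kernel :: "'a topology \<Rightarrow> 'a set" where
  "perfect_kernel X =
     (THE P. \<exists>\<alpha>. \<forall>\<beta>. (\<alpha>, \<beta>) \<in> |UNIV::'a set set| \<longrightarrow>
                cb_derivative |UNIV::'a set set| X \<beta> = P)"

lemma ord_pred_unique:
  assumes "Well_order r" "ord_pred r \<beta> \<alpha>" "ord_pred r \<gamma> \<alpha>"
  shows "\<beta> = \<gamma>"
  using assms
  by (auto simp: ord_pred_def well_order_on_def linear_order_on_def partial_order_on_def
      dest: antisymD)

lemma cb_derivative_unfold:
  assumes "Well_order r"
  shows "cb_derivative r X \<alpha> =
     (if underS r \<alpha> = {} then topspace X
      else if \<exists>\<beta>. ord_pred r \<beta> \<alpha> then cb_derive X (cb_derivative r X (THE \<beta>. ord_pred r \<beta> \<alpha>))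
      else (\<Inter>\<beta>\<in>underS r \<alpha>. cb_derivative r X \<beta>))"
proof -
  let ?H = "\<lambda>(D::'a \<Rightarrow> 'b set) \<alpha>.
     if underS r \<alpha> = {} then topspace X
     else if \<exists>\<beta>. ord_pred r \<beta> \<alpha> then cb_derive X (D (THE \<beta>. ord_pred r \<beta> \<alpha>))
     else (\<Inter>\<beta>\<in>underS r \<alpha>. D \<beta>)"
  interpret R: wo_rel r using assms by (simp add: wo_rel_def)
  have "R.adm_wo ?H"
    unfolding R.adm_wo_def
  proof (intro allI impI)
    fix f g :: "'a \<Rightarrow> 'b set" and x
    assume eq: "\<forall>y\<in>underS r x. f y = g y"
    have "f (THE \<beta>. ord_pred r \<beta> x) = g (THE \<beta>. ord_pred r \<beta> x)" if ex: "\<exists>\<beta>. ord_pred r \<beta> x"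
    proof -
      obtain \<beta> where \<beta>: "ord_pred r \<beta> x" using ex by blast
      have "(THE \<beta>. ord_pred r \<beta> x) = \<beta>"
        by (rule the_equality[of "\<lambda>\<beta>. ord_pred r \<beta> x", OF \<beta>], rule ord_pred_unique[OF assms _ \<beta>])
      then show ?thesis using \<beta> eq by (simp add: ord_pred_def)
    qed
    then show "?H f x = ?H g x" using eq by auto
  qed
  then have "R.worec ?H = ?H (R.worec ?H)" by (rule R.worec_fixpoint)
  then show ?thesis
    unfolding cb_derivative_def by (rule fun_cong)
qed

lemma cb_derivative_zero:
  "Well_order r \<Longrightarrow> underS r \<alpha> = {} \<Longrightarrow> cb_derivative r X \<alpha> = topspace X"
  using cb_derivative_unfold[of r X \<alpha>] by presburger

lemma cb_derivative_succ:
  assumes "Well_order r" "ord_pred r \<beta> \<alpha>"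
  shows "cb_derivative r X \<alpha> = cb_derive X (cb_derivative r X \<beta>)"
proof -
  have "(THE \<beta>. ord_pred r \<beta> \<alpha>) = \<beta>"
    by (rule the_equality[of "\<lambda>\<beta>. ord_pred r \<beta> \<alpha>", OF assms(2)], rule ord_pred_unique[OF assms(1) _ assms(2)])
  moreover have "underS r \<alpha> \<noteq> {}" using assms by (auto simp: ord_pred_def)
  moreover have "\<exists>\<beta>. ord_pred r \<beta> \<alpha>" using assms(2) by blast
  ultimately show ?thesis using cb_derivative_unfold[OF assms(1), of X \<alpha>] by presburger
qed

lemma cb_derivative_limit:
  "Well_order r \<Longrightarrow> underS r \<alpha> \<noteq> {} \<Longrightarrow> \<nexists>\<beta>. ord_pred r \<beta> \<alpha> \<Longrightarrow>
     cb_derivative r X \<alpha> = (\<Inter>\<beta>\<in>underS r \<alpha>. cb_derivative r X \<beta>)"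
  using cb_derivative_unfold[of r X \<alpha>] by presburger

lemma cb_derive_subset: "cb_derive X S \<subseteq> S"
  by (auto simp: cb_derive_def derived_set_of_subtopology)

lemma cb_derive_mono: "S \<subseteq> T \<Longrightarrow> cb_derive X S \<subseteq> cb_derive X T"
  using derived_set_of_mono[of S T X] by (auto simp: cb_derive_def derived_set_of_subtopology)

lemma cb_derive_subset_topspace: "cb_derive X S \<subseteq> topspace X"
  using derived_set_of_subset_topspace[of X S] by (auto simp: cb_derive_def derived_set_of_subtopology)

lemma not_le_underS:
  assumes "Well_order r" "\<alpha> \<in> Field r" "\<beta> \<in> Field r" "(\<alpha>, \<beta>) \<notin> r"
  shows "\<beta> \<in> underS r \<alpha>"
proof -
  interpret R: wo_rel r using assms(1) by (simp add: wo_rel_def)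
  have "(\<beta>, \<beta>) \<in> r" using R.REFL assms(3) by (simp add: refl_on_def)
  then have "\<beta> \<noteq> \<alpha>" using assms(4) by metis
  moreover have "(\<beta>, \<alpha>) \<in> r" using R.TOTALS assms by blast
  ultimately show ?thesis by (simp add: underS_def)
qed

lemma cb_derivative_decreasing:
  assumes wo: "Well_order r" and "\<alpha> \<in> underS r \<beta>"
  shows "cb_derivative r X \<beta> \<subseteq> cb_derive X (cb_derivative r X \<alpha>)"
  using assms(2)
proof (induction \<beta> rule: wo_rel.well_order_induct[of r])
  case 1
  then show ?case using wo by (simp add: wo_rel_def)
next
  case (2 \<beta>)
  interpret R: wo_rel r using wo by (simp add: wo_rel_def)
  have below: "cb_derivative r X \<gamma> \<subseteq> cb_derive X (cb_derivative r X \<alpha>)"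
    if "\<gamma> \<in> underS r \<beta>" "\<alpha> \<in> underS r \<gamma>" for \<gamma>
    using 2(1) that by (auto simp: underS_def)
  consider (succ) \<gamma> where "ord_pred r \<gamma> \<beta>" | (limit) "\<nexists>\<gamma>. ord_pred r \<gamma> \<beta>" by blast
  then show ?case
  proof cases
    case succ
    show ?thesis
    proof (cases "\<alpha> = \<gamma>")
      case True
      then show ?thesis using cb_derivative_succ[OF wo succ, of X] by simp
    next
      case False
      then have "\<alpha> \<in> underS r \<gamma>" "\<gamma> \<in> underS r \<beta>"
        using succ 2(2) by (auto simp: ord_pred_def underS_def)
      then show ?thesis
        using below[of \<gamma>] cb_derivative_succ[OF wo succ, of X] cb_derive_subset[of X "cb_derivative r X \<gamma>"]
        by (metis subset_trans)
    qed
  next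
    case limit
    then obtain \<gamma> where \<gamma>: "\<gamma> \<in> underS r \<beta>" "(\<gamma>, \<alpha>) \<notin> r"
      using 2(2) by (auto simp: ord_pred_def)
    have "\<gamma> \<in> Field r" "\<alpha> \<in> Field r"
      using \<gamma>(1) 2(2) by (auto simp: underS_def Field_def)
    then have "\<alpha> \<in> underS r \<gamma>"
      using not_le_underS[OF wo] \<gamma>(2) by metis
    then have "cb_derivative r X \<gamma> \<subseteq> cb_derive X (cb_derivative r X \<alpha>)" by (rule below[OF \<gamma>(1)])
    moreover have "cb_derivative r X \<beta> = (\<Inter>\<delta>\<in>underS r \<beta>. cb_derivative r X \<delta>)"
      by (rule cb_derivative_limit[OF wo _ limit]) (use \<gamma>(1) in blast)
    then have "cb_derivative r X \<beta> \<subseteq> cb_derivative r X \<gamma>" using \<gamma>(1) by (simp add: INF_lower)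
    ultimately show ?thesis by (rule subset_trans[rotated])
  qed
qed

lemma cb_derivative_stationary:
  assumes wo: "Well_order r"
    and fixp: "cb_derive X (cb_derivative r X \<alpha>) = cb_derivative r X \<alpha>"
    and "(\<alpha>, \<beta>) \<in> r"
  shows "cb_derivative r X \<beta> = cb_derivative r X \<alpha>"
  using assms(3)
proof (induction \<beta> rule: wo_rel.well_order_induct[of r])
  case 1
  then show ?case using wo by (simp add: wo_rel_def)
next
  case (2 \<beta>)
  interpret R: wo_rel r using wo by (simp add: wo_rel_def)
  show ?case
  proof (cases "\<alpha> = \<beta>")
    case False
    then have \<alpha>: "\<alpha> \<in> underS r \<beta>" using 2(2) by (simp add: underS_def)
    have IH: "cb_derivative r X \<gamma> = cb_derivative r X \<alpha>"
      if "\<gamma> \<in> underS r \<beta>" "(\<alpha>, \<gamma>) \<in> r" for \<gamma>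
      using 2(1) that by (auto simp: underS_def)
    consider (succ) \<gamma> where "ord_pred r \<gamma> \<beta>" | (limit) "\<nexists>\<gamma>. ord_pred r \<gamma> \<beta>" by blast
    then show ?thesis
    proof cases
      case succ
      then have "cb_derivative r X \<gamma> = cb_derivative r X \<alpha>"
        using IH \<alpha> by (simp add: ord_pred_def)
      then show ?thesis using cb_derivative_succ[OF wo succ, of X] fixp by simp
    next
      case limit
      have "cb_derivative r X \<alpha> \<subseteq> cb_derivative r X \<gamma>" if \<gamma>: "\<gamma> \<in> underS r \<beta>" for \<gamma>
      proof (cases "(\<alpha>, \<gamma>) \<in> r")
        case True
        then show ?thesis using IH \<gamma> by simp
      next
        case False
        have "\<gamma> \<in> Field r" "\<alpha> \<in> Field r"
          using \<gamma> \<alpha> by (auto simp: underS_def Field_def)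
        then have "\<gamma> \<in> underS r \<alpha>"
          using not_le_underS[OF wo] False by metis
        then have "cb_derivative r X \<alpha> \<subseteq> cb_derive X (cb_derivative r X \<gamma>)"
          by (rule cb_derivative_decreasing[OF wo])
        then show ?thesis using cb_derive_subset by (rule subset_trans)
      qed
      moreover have "cb_derivative r X \<beta> = (\<Inter>\<gamma>\<in>underS r \<beta>. cb_derivative r X \<gamma>)"
        by (rule cb_derivative_limit[OF wo _ limit]) (use \<alpha> in blast)
      ultimately have "cb_derivative r X \<alpha> \<subseteq> cb_derivative r X \<beta>" by (simp add: INF_greatest)
      moreover have "cb_derivative r X \<beta> \<subseteq> cb_derivative r X \<alpha>"
        using cb_derivative_decreasing[OF wo \<alpha>, of X] fixp by simp
      ultimately show ?thesis by (rule equalityI[rotated])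
    qed
  qed simp
qed

lemma cb_derivative_fixpoint_exists:
  fixes X :: "'a topology" and r :: "'o rel"
  assumes card: "Card_order r" and large: "|UNIV::'a set| <o r"
  shows "\<exists>\<alpha>\<in>Field r. cb_derive X (cb_derivative r X \<alpha>) = cb_derivative r X \<alpha>"
proof (rule ccontr)
  have wo: "Well_order r" using card by (simp add: card_order_on_def)
  interpret R: wo_rel r using wo by (simp add: wo_rel_def)
  let ?D = "cb_derivative r X"
  assume neg: "\<not> ?thesis"
  have "\<exists>x. x \<in> ?D \<alpha> - cb_derive X (?D \<alpha>)" if "\<alpha> \<in> Field r" for \<alpha>
    using neg that cb_derive_subset[of X "?D \<alpha>"] by (metis Diff_eq_empty_iff equalityI ex_in_conv)
  then obtain f where f: "\<forall>\<alpha>\<in>Field r. f \<alpha> \<in> ?D \<alpha> - cb_derive X (?D \<alpha>)" by metis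
  have sep: "f \<alpha> \<noteq> f \<beta>" if "\<alpha> \<in> underS r \<beta>" for \<alpha> \<beta>
  proof -
    have "\<alpha> \<in> Field r" "\<beta> \<in> Field r" using that by (auto simp: underS_def Field_def)
    then have "f \<alpha> \<notin> cb_derive X (?D \<alpha>)" "f \<beta> \<in> ?D \<beta>" using f by auto
    then show ?thesis using cb_derivative_decreasing[OF wo that, of X] by (metis subsetD)
  qed
  have "inj_on f (Field r)"
  proof (rule inj_onI, rule ccontr)
    fix \<alpha> \<beta> assume "\<alpha> \<in> Field r" "\<beta> \<in> Field r" "f \<alpha> = f \<beta>" "\<alpha> \<noteq> \<beta>"
    then have "\<alpha> \<in> underS r \<beta> \<or> \<beta> \<in> underS r \<alpha>"
      using not_le_underS[OF wo, of \<beta> \<alpha>] by (auto simp: underS_def)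
    then show False using sep \<open>f \<alpha> = f \<beta>\<close> by metis
  qed
  then have "|Field r| \<le>o |UNIV::'a set|" using card_of_ordLeq by blast
  then have "r \<le>o |UNIV::'a set|"
    using card card_of_Field_ordIso ordIso_ordLeq_trans ordIso_symmetric by blast
  then show False using large not_ordLess_ordLeq by blast
qed

lemma perfect_kernel_fixpoint:
  fixes X :: "'a topology"
  shows "\<exists>\<alpha>. cb_derive X (cb_derivative |UNIV::'a set set| X \<alpha>) = cb_derivative |UNIV::'a set set| X \<alpha> \<and>
             perfect_kernel X = cb_derivative |UNIV::'a set set| X \<alpha>"
proof -
  let ?r = "|UNIV::'a set set|"
  let ?D = "cb_derivative ?r X"
  have wo: "Well_order ?r" by (rule card_of_Well_order)
  interpret R: wo_rel ?r using wo by (simp add: wo_rel_def)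
  have "|UNIV::'a set| <o ?r" using card_of_Pow[of "UNIV::'a set"] by simp
  then obtain \<alpha> where \<alpha>: "cb_derive X (?D \<alpha>) = ?D \<alpha>"
    using cb_derivative_fixpoint_exists[of ?r X, OF card_of_Card_order] by blast
  then have stat: "\<forall>\<beta>. (\<alpha>, \<beta>) \<in> ?r \<longrightarrow> ?D \<beta> = ?D \<alpha>"
    using cb_derivative_stationary[OF wo] by blast
  have "perfect_kernel X = ?D \<alpha>"
    unfolding perfect_kernel_def
  proof (rule the_equality)
    show "\<exists>\<alpha>'. \<forall>\<beta>. (\<alpha>', \<beta>) \<in> ?r \<longrightarrow> ?D \<beta> = ?D \<alpha>" using stat by blast
  next
    fix P assume "\<exists>\<alpha>'. \<forall>\<beta>. (\<alpha>', \<beta>) \<in> ?r \<longrightarrow> ?D \<beta> = P"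
    then obtain \<alpha>' where \<alpha>': "\<forall>\<beta>. (\<alpha>', \<beta>) \<in> ?r \<longrightarrow> ?D \<beta> = P" by blast
    have F: "\<alpha> \<in> Field ?r" "\<alpha>' \<in> Field ?r" unfolding Field_card_of by simp_all
    have refl: "(\<alpha>, \<alpha>) \<in> ?r" "(\<alpha>', \<alpha>') \<in> ?r" using R.REFL F by (simp_all add: refl_on_def)
    show "P = ?D \<alpha>"
    proof (cases "(\<alpha>, \<alpha>') \<in> ?r")
      case True
      then have "?D \<alpha>' = ?D \<alpha>" using stat by simp
      moreover have "?D \<alpha>' = P" using \<alpha>' refl(2) by simp
      ultimately show ?thesis by simp
    next
      case False
      then have "(\<alpha>', \<alpha>) \<in> ?r" using R.TOTALS F by blast
      then show ?thesis using \<alpha>' by simp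
    qed
  qed
  then show ?thesis using \<alpha> by blast
qed

lemma cb_derive_perfect_kernel: "cb_derive X (perfect_kernel X) = perfect_kernel X"
  using perfect_kernel_fixpoint[of X] by metis

lemma perfect_kernel_eventual:
  fixes X :: "'a topology"
  shows "\<exists>\<alpha>. \<forall>\<beta>. (\<alpha>, \<beta>) \<in> |UNIV::'a set set| \<longrightarrow>
             cb_derivative |UNIV::'a set set| X \<beta> = perfect_kernel X"
proof -
  have wo: "Well_order |UNIV::'a set set|" by (rule card_of_Well_order)
  obtain \<alpha> where \<alpha>:
      "cb_derive X (cb_derivative |UNIV::'a set set| X \<alpha>) = cb_derivative |UNIV::'a set set| X \<alpha>"
      "perfect_kernel X = cb_derivative |UNIV::'a set set| X \<alpha>"
    using perfect_kernel_fixpoint[of X] by blast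
  show ?thesis using cb_derivative_stationary[OF wo \<alpha>(1)] \<alpha>(2) by auto
qed

lemma dense_in_itself_subset_cb_derivative:
  assumes wo: "Well_order r" and S: "S \<subseteq> topspace X" "S \<subseteq> cb_derive X S"
  shows "S \<subseteq> cb_derivative r X \<alpha>"
proof (induction \<alpha> rule: wo_rel.well_order_induct[of r])
  case 1
  then show ?case using wo by (simp add: wo_rel_def)
next
  case (2 \<alpha>)
  then have IH: "S \<subseteq> cb_derivative r X \<beta>" if "\<beta> \<in> underS r \<alpha>" for \<beta>
    using that by (auto simp: underS_def)
  consider (zero) "underS r \<alpha> = {}" | (succ) \<beta> where "ord_pred r \<beta> \<alpha>"
    | (limit) "underS r \<alpha> \<noteq> {}" "\<nexists>\<beta>. ord_pred r \<beta> \<alpha>" by blast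
  then show ?case
  proof cases
    case zero
    then show ?thesis using cb_derivative_zero[OF wo zero, of X] S(1) by simp
  next
    case succ
    then have "S \<subseteq> cb_derivative r X \<beta>" using IH by (simp add: ord_pred_def)
    then have "cb_derive X S \<subseteq> cb_derive X (cb_derivative r X \<beta>)"
      by (rule cb_derive_mono)
    then show ?thesis using cb_derivative_succ[OF wo succ, of X] S(2) by (metis subset_trans)
  next
    case limit
    then show ?thesis using cb_derivative_limit[OF wo limit, of X] IH by (simp add: INF_greatest)
  qed
qed

lemma cb_derivative_eq_perfect_kernel:
  fixes X :: "'a topology" and r :: "'o rel"
  assumes wo: "Well_order r"
    and fixp: "cb_derive X (cb_derivative r X \<alpha>) = cb_derivative r X \<alpha>"
  shows "cb_derivative r X \<alpha> = perfect_kernel X"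
proof -
  let ?r = "|UNIV::'a set set|"
  have wo': "Well_order ?r" by (rule card_of_Well_order)
  obtain \<beta> where \<beta>: "cb_derive X (cb_derivative ?r X \<beta>) = cb_derivative ?r X \<beta>"
      "perfect_kernel X = cb_derivative ?r X \<beta>"
    using perfect_kernel_fixpoint[of X] by blast
  have "cb_derivative r X \<alpha> \<subseteq> topspace X" "cb_derivative ?r X \<beta> \<subseteq> topspace X"
    using cb_derive_subset_topspace[of X] fixp \<beta>(1) by metis+
  then have "cb_derivative r X \<alpha> \<subseteq> cb_derivative ?r X \<beta>" "cb_derivative ?r X \<beta> \<subseteq> cb_derivative r X \<alpha>"
    using dense_in_itself_subset_cb_derivative[OF wo', of "cb_derivative r X \<alpha>" X]
      dense_in_itself_subset_cb_derivative[OF wo, of "cb_derivative ?r X \<beta>" X] fixp \<beta>(1)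
    by simp_all
  then show ?thesis using \<beta>(2) by simp
qed


section \<open>Cotype\<close>

definition rademacher :: "nat \<Rightarrow> real \<Rightarrow> real" where
  "rademacher i t = sgn (sin (2 ^ i * pi * t))"

definition nontrivial_cotype :: "'e::banach itself \<Rightarrow> bool" where
  "nontrivial_cotype _ \<longleftrightarrow>
     (\<exists>q\<ge>2. \<exists>C>0. \<forall>(n::nat) (e::nat \<Rightarrow> 'e).
        (\<Sum>i=1..n. norm (e i) powr q) powr (1 / q)
          \<le> C * (integral {0..1} (\<lambda>t. (norm (\<Sum>i=1..n. rademacher i t *\<^sub>R e i))\<^sup>2)) powr (1 / 2))"


section \<open>Isomorphism of normed spaces\<close>

definition isomorphic_spaces ::
  "'v::real_normed_vector itself \<Rightarrow> 'w::real_normed_vector itself \<Rightarrow> bool" where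
  "isomorphic_spaces _ _ \<longleftrightarrow>
     (\<exists>(T :: 'v \<Rightarrow> 'w) S. linear T \<and> homeomorphism UNIV UNIV T S)"

end

theory Submission
  imports Defs
begin

text \<open>Let \<open>T : C(K\<^sub>1, E\<^sub>1) \<rightarrow> C(K\<^sub>2, E\<^sub>2)\<close> be an isomorphism and \<open>P\<close> the perfect kernel of \<open>K\<^sub>2\<close>. If functions
  \<open>f\<^sub>i\<close> of norm at most \<open>1\<close> have a point-bounded family of supports, cotype makes
  the sets \<open>{y. \<parallel>(T f\<^sub>i)(y)\<parallel> > \<delta>}\<close> point-bounded as well. Applying this to the inverse of \<open>T\<close> turns a
  disjoint open family in \<open>K\<^sub>2\<close> into a point-bounded one in \<open>K\<^sub>1\<close>, and applying it to \<open>T\<close> leads back to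
  \<open>K\<^sub>2\<close>; the sets obtained there can be made to meet \<open>P\<close>, because every nonempty open
  \<open>U \<subseteq> K\<^sub>1\<close> supports some \<open>f\<close> of norm at most \<open>1\<close> with \<open>\<parallel>T f\<parallel>\<close> bounded below at a point of \<open>P\<close>.

  For this lower bound, transfinite induction on \<open>\<alpha>\<close> shows that if a closed \<open>L\<close> misses the derivative
  \<open>K\<^sub>2\<^sup>(\<^sup>\<alpha>\<^sup>)\<close>, then each \<open>U\<close> supports a bump with \<open>T\<close>-image uniformly small on \<open>L\<close>. At a successor
  \<open>\<alpha> = \<beta> + 1\<close> only finitely many points of \<open>L\<close> lie in \<open>K\<^sub>2\<^sup>(\<^sup>\<beta>\<^sup>)\<close>; since \<open>K\<^sub>1\<close> is perfect, cotype
  yields a smaller \<open>U\<close> on which \<open>T\<close> is small at these points, and averaging nested bumps handles the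
  rest of \<open>L\<close>. If \<open>T f\<close> were small on \<open>P\<close> for all \<open>f\<close> supported in \<open>U\<close>, the same averaging with
  \<open>L = K\<^sub>2\<close> would contradict the boundedness of the inverse of \<open>T\<close>.\<close>

lemma apply_bcontfun_sum [simp]:
  fixes f :: "'i \<Rightarrow> 'a::topological_space \<Rightarrow>\<^sub>C 'e::real_normed_vector"
  shows "apply_bcontfun (\<Sum>i\<in>I. f i) x = (\<Sum>i\<in>I. f i x)"
  by (induction I rule: infinite_finite_induct) auto

section \<open>Bounded operators and cotype\<close>

text \<open>The inverse of a linear bijection is linear, and continuity at \<open>0\<close> becomes
  a norm bound by rescaling.\<close>

lemma isomorphic_spaces_bounded_linear:
  assumes "isomorphic_spaces TYPE('v::real_normed_vector) TYPE('w::real_normed_vector)"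
  obtains T :: "'v::real_normed_vector \<Rightarrow> 'w::real_normed_vector" and S
  where "bounded_linear T" "bounded_linear S" "\<And>v. S (T v) = v" "\<And>w. T (S w) = w"
proof -
  obtain T :: "'v \<Rightarrow> 'w" and S where T: "linear T" and hom: "homeomorphism UNIV UNIV T S"
    using assms by (auto simp: isomorphic_spaces_def)
  have inv: "S (T v) = v" "T (S w) = w" for v w
    using hom by (simp_all add: homeomorphism_def)
  have "linear S"
  proof (rule linearI)
    show "S (a + b) = S a + S b" for a b
      using linear_add[OF T, of "S a" "S b"] inv by metis
    show "S (r *\<^sub>R a) = r *\<^sub>R S a" for r a
      using linear_scale[OF T, of r "S a"] inv by metis
  qed
  have bounded: "bounded_linear f"
    if lin: "linear f" and cont: "continuous_on UNIV f"
    for f :: "'x::real_normed_vector \<Rightarrow> 'y::real_normed_vector"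
  proof -
    have "isCont f 0" using cont by (simp add: continuous_on_eq_continuous_at)
    then obtain d where d: "d > 0" "\<And>x. norm x < d \<Longrightarrow> norm (f x) < 1"
      using linear_0[OF lin] by (auto simp: continuous_at_eps_delta dist_norm dest!: spec[of _ 1])
    have "norm (f x) \<le> norm x * (2 / d)" for x
    proof (cases "x = 0")
      case True
      then show ?thesis using linear_0[OF lin] by simp
    next
      case False
      define c where "c = d / (2 * norm x)"
      have c: "c > 0" using False d by (simp add: c_def)
      have "norm (c *\<^sub>R x) < d" using False d by (simp add: c_def)
      then have "norm (f (c *\<^sub>R x)) < 1" by (rule d)
      then have "c * norm (f x) < 1" using c by (simp add: linear_scale[OF lin])
      then show ?thesis using c False d by (simp add: c_def field_simps)
    qed
    then show ?thesis using lin linear_conv_bounded_linear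
      by (intro bounded_linear.intro bounded_linear_axioms.intro) blast+
  qed
  show ?thesis
    using that[OF bounded[OF T] bounded[OF \<open>linear S\<close>]] hom inv by (simp add: homeomorphism_def)
qed

lemma finite_card_le_1I:
  assumes "\<And>i j. i \<in> S \<Longrightarrow> j \<in> S \<Longrightarrow> i = j"
  shows "finite S \<and> card S \<le> 1"
proof (rule finite_if_finite_subsets_card_bdd)
  fix G assume "G \<subseteq> S" "finite G"
  then show "card G \<le> 1" using assms by (simp add: card_le_Suc0_iff_eq subset_iff)
qed

lemma rademacher_abs_le_1: "\<bar>rademacher i t\<bar> \<le> 1"
  by (simp add: rademacher_def sgn_real_def)

text \<open>Rademacher values are admissible coefficients, so the right side of the cotype
  inequality is at most \<open>C * M\<close>, while \<open>n\<close> vectors of norm at least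
  \<open>\<delta>\<close> make the left side at least \<open>\<delta>\<close> times the
  \<open>q\<close>-th root of \<open>n\<close>. Coefficients in [-1, 1] rather than signs are needed
  because \<open>rademacher\<close> takes the value \<open>0\<close> at some points.\<close>

lemma cotype_card_bound:
  fixes M \<delta> :: real
  assumes "nontrivial_cotype TYPE('e::banach)" and "\<delta> > 0"
  obtains k :: nat where
    "\<And>(I :: 'i set) (e :: 'i \<Rightarrow> 'e). finite I \<Longrightarrow> (\<And>i. i \<in> I \<Longrightarrow> \<delta> \<le> norm (e i)) \<Longrightarrow>
       (\<forall>c. (\<forall>i. \<bar>c i\<bar> \<le> 1) \<longrightarrow> norm (\<Sum>i\<in>I. c i *\<^sub>R e i) \<le> M) \<Longrightarrow> card I \<le> k"
proof -
  obtain q C where q: "q \<ge> 2" and C: "C > 0" and cotype: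
    "\<And>n (e :: nat \<Rightarrow> 'e). (\<Sum>i=1..n. norm (e i) powr q) powr (1 / q)
       \<le> C * (integral {0..1} (\<lambda>t. (norm (\<Sum>i=1..n. rademacher i t *\<^sub>R e i))\<^sup>2)) powr (1 / 2)"
    using assms(1) unfolding nontrivial_cotype_def by blast
  \<comment> \<open>This solves \<open>n * \<delta> powr q \<le> (C * M) powr q\<close> for
    \<open>n\<close>. The absolute value is there because \<open>M \<ge> 0\<close> follows only once
    some \<open>I\<close> satisfies the assumptions, by taking all coefficients
    \<open>0\<close>.\<close>
  define k where "k = nat \<lceil>(C * \<bar>M\<bar>) powr q / \<delta> powr q\<rceil>"
  have "card I \<le> k"
    if I: "finite I" and large: "\<And>i. i \<in> I \<Longrightarrow> \<delta> \<le> norm (e i)"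
      and signs: "\<forall>c. (\<forall>i. \<bar>c i\<bar> \<le> 1) \<longrightarrow> norm (\<Sum>i\<in>I. c i *\<^sub>R e i) \<le> M"
    for I :: "'i set" and e :: "'i \<Rightarrow> 'e"
  proof -
    define n where "n = card I"
    obtain b where b: "bij_betw b {1..n} I"
      using ex_bij_betw_nat_finite_1[OF I] unfolding n_def by blast
    have M: "M \<ge> 0" using spec[OF signs, of "\<lambda>_. 0"] by simp
    define F where "F t = (norm (\<Sum>i=1..n. rademacher i t *\<^sub>R e (b i)))\<^sup>2" for t
    have F: "F t \<le> M\<^sup>2" for t
    proof -
      have "(\<Sum>i=1..n. rademacher i t *\<^sub>R e (b i))
          = (\<Sum>j\<in>I. rademacher (inv_into {1..n} b j) t *\<^sub>R e j)"
      proof (subst sum.reindex_bij_betw[OF b, symmetric], rule sum.cong)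
        fix i assume "i \<in> {1..n}"
        then show "rademacher i t *\<^sub>R e (b i) = rademacher (inv_into {1..n} b (b i)) t *\<^sub>R e (b i)"
          using bij_betw_inv_into_left[OF b] by simp
      qed simp
      also have "norm \<dots> \<le> M" using spec[OF signs, of "\<lambda>j. rademacher (inv_into {1..n} b j) t"] rademacher_abs_le_1 by simp
      finally show ?thesis unfolding F_def by (rule power_mono) simp
    qed
    \<comment> \<open>The integral of a non-integrable function is \<open>0\<close>, so measurability of \<open>F\<close> is irrelevant.\<close>
    have int: "0 \<le> integral {0..1} F \<and> integral {0..1} F \<le> M\<^sup>2"
    proof (cases "F integrable_on {0..1}")
      case True
      have "integral {0..1} F \<le> integral {0..1} (\<lambda>_::real. M\<^sup>2)"
        by (rule integral_le[OF True]) (use F in auto)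
      moreover have "0 \<le> integral {0..1} F"
        by (rule integral_nonneg[OF True]) (simp add: F_def)
      ultimately show ?thesis by simp
    next
      case False
      then show ?thesis by (simp add: not_integrable_integral)
    qed
    have "integral {0..1} F powr (1 / 2) \<le> (M\<^sup>2) powr (1 / 2)"
      by (rule powr_mono2) (use int in auto)
    also have "\<dots> = M" using M by (simp add: powr_half_sqrt)
    finally have "integral {0..1} F powr (1 / 2) \<le> M" .
    let ?S = "\<Sum>i=1..n. norm (e (b i)) powr q"
    have "?S powr (1 / q) \<le> C * (integral {0..1} F powr (1 / 2))"
      using cotype[of "\<lambda>i. e (b i)" n] unfolding F_def .
    also have "\<dots> \<le> C * M"
      using \<open>integral {0..1} F powr (1 / 2) \<le> M\<close> C by (simp add: mult_left_mono)
    finally have "(?S powr (1 / q)) powr q \<le> (C * M) powr q"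
      using q by (intro powr_mono2) auto
    moreover have "(?S powr (1 / q)) powr q = ?S"
      using q by (simp add: powr_powr sum_nonneg)
    moreover have "real n * \<delta> powr q \<le> ?S"
    proof -
      have "(\<Sum>i=1..n. \<delta> powr q) \<le> ?S"
      proof (rule sum_mono)
        fix i assume "i \<in> {1..n}"
        then have "b i \<in> I" using b by (auto simp: bij_betw_def)
        then show "\<delta> powr q \<le> norm (e (b i)) powr q"
          using large \<open>\<delta> > 0\<close> q by (intro powr_mono2) auto
      qed
      then show ?thesis by simp
    qed
    ultimately have "real n * \<delta> powr q \<le> (C * \<bar>M\<bar>) powr q" using M by simp
    then have "real n \<le> (C * \<bar>M\<bar>) powr q / \<delta> powr q"
      using \<open>\<delta> > 0\<close> by (simp add: field_simps)
    then show ?thesis unfolding k_def n_def by linarith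
  qed
  then show ?thesis by (rule that)
qed

text \<open>At most \<open>k\<close> of the \<open>f i\<close> are nonzero at any point, so
  combinations with coefficients in [-1, 1] have norm at most \<open>k\<close> and
  \<open>T\<close>-images of norm at most \<open>k * B\<close>. Cotype is then applied at a fixed
  \<open>y\<close> to the vectors \<open>T (f i) y\<close>, not in the function space.\<close>

lemma point_bounded_image:
  fixes T :: "('a::topological_space \<Rightarrow>\<^sub>C 'e::real_normed_vector) \<Rightarrow> 'b::topological_space \<Rightarrow>\<^sub>C 'f::banach"
    and f :: "'i \<Rightarrow> 'a \<Rightarrow>\<^sub>C 'e"
  assumes cotype: "nontrivial_cotype TYPE('f)" and T: "bounded_linear T" and "\<delta> > 0"
    and f: "\<And>i x. i \<in> I \<Longrightarrow> norm (f i x) \<le> 1"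
    and k: "\<And>x. finite {i \<in> I. f i x \<noteq> 0} \<and> card {i \<in> I. f i x \<noteq> 0} \<le> k"
  obtains k' where
    "\<And>y. finite {i \<in> I. \<delta> \<le> norm (T (f i) y)} \<and> card {i \<in> I. \<delta> \<le> norm (T (f i) y)} \<le> k'"
proof -
  interpret T: bounded_linear T by (rule T)
  obtain B where B: "\<And>g. norm (T g) \<le> norm g * B" "B > 0" using T.pos_bounded by blast
  obtain k' where k': "\<And>(J :: 'i set) (e :: 'i \<Rightarrow> 'f). finite J \<Longrightarrow> (\<And>i. i \<in> J \<Longrightarrow> \<delta> \<le> norm (e i)) \<Longrightarrow>
       (\<forall>c. (\<forall>i. \<bar>c i\<bar> \<le> 1) \<longrightarrow> norm (\<Sum>i\<in>J. c i *\<^sub>R e i) \<le> real k * B) \<Longrightarrow> card J \<le> k'"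
    using cotype_card_bound[OF cotype \<open>\<delta> > 0\<close>] by blast
  \<comment> \<open>Finiteness of the whole index set is not known yet, so its finite subsets are
    bounded uniformly first.\<close>
  have "card J \<le> k'" if J: "J \<subseteq> {i \<in> I. \<delta> \<le> norm (T (f i) y)}" "finite J" for J y
  proof (rule k'[OF J(2)])
    show "\<delta> \<le> norm (T (f i) y)" if "i \<in> J" for i using that J by auto
    show "\<forall>c. (\<forall>i. \<bar>c i\<bar> \<le> 1) \<longrightarrow> norm (\<Sum>i\<in>J. c i *\<^sub>R T (f i) y) \<le> real k * B"
    proof (intro allI impI)
      fix c :: "'i \<Rightarrow> real" assume c: "\<forall>i. \<bar>c i\<bar> \<le> 1"
      let ?g = "\<Sum>i\<in>J. c i *\<^sub>R f i"
      have "norm ?g \<le> real k"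
      proof (rule norm_bound)
        fix x
        let ?N = "{i \<in> J. f i x \<noteq> 0}"
        have "?g x = (\<Sum>i\<in>?N. c i *\<^sub>R f i x)"
          using J(2) by (auto intro!: sum.mono_neutral_right)
        also have "norm \<dots> \<le> (\<Sum>i\<in>?N. 1)"
        proof (rule sum_norm_le)
          fix i assume "i \<in> ?N"
          then show "norm (c i *\<^sub>R f i x) \<le> 1"
            using c f[of i x] J mult_mono[of "\<bar>c i\<bar>" 1 "norm (f i x)" 1] by auto
        qed
        also have "\<dots> = real (card ?N)" by simp
        also have "card ?N \<le> card {i \<in> I. f i x \<noteq> 0}"
          by (rule card_mono) (use k J in auto)
        also have "\<dots> \<le> k" using k by simp
        finally show "norm (?g x) \<le> real k" by simp
      qed
      have "norm (\<Sum>i\<in>J. c i *\<^sub>R T (f i) y) = norm (T ?g y)"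
        by (simp add: T.sum T.scaleR)
      also have "\<dots> \<le> norm (T ?g)" by (rule norm_bounded)
      also have "\<dots> \<le> norm ?g * B" by (rule B)
      also have "\<dots> \<le> real k * B" using \<open>norm ?g \<le> real k\<close> B(2) by (simp add: mult_right_mono)
      finally show "norm (\<Sum>i\<in>J. c i *\<^sub>R T (f i) y) \<le> real k * B" .
    qed
  qed
  then show ?thesis
    by (intro that finite_if_finite_subsets_card_bdd)
qed

text \<open>An open set meeting \<open>A\<close> contains two points of \<open>A\<close>, and
  separating them gives two disjoint open pieces that meet \<open>A\<close>. One piece is kept, the
  other is split again.\<close>

lemma disjoint_open_sequence_meeting:
  fixes A U :: "'a::t2_space set"
  assumes A: "\<And>x. x \<in> A \<Longrightarrow> x islimpt A" and U: "open U" "A \<inter> U \<noteq> {}"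
  obtains W :: "nat \<Rightarrow> 'a set"
  where "\<And>n. open (W n)" "\<And>n. W n \<subseteq> U" "\<And>n. A \<inter> W n \<noteq> {}" "disjoint_family W"
proof -
  define ok where "ok V = (open V \<and> V \<subseteq> U \<and> A \<inter> V \<noteq> {})" for V
  have split: "\<exists>W V'. ok W \<and> ok V' \<and> W \<subseteq> V \<and> V' \<subseteq> V \<and> W \<inter> V' = {}" if V: "ok V" for V
  proof -
    obtain x where x: "x \<in> A" "x \<in> V" using V by (auto simp: ok_def)
    then obtain y where y: "y \<in> A" "y \<in> V" "y \<noteq> x"
      using A[of x] V unfolding ok_def islimpt_def by blast
    obtain P Q where PQ: "open P" "open Q" "x \<in> P" "y \<in> Q" "P \<inter> Q = {}"
      using hausdorff[of x y] y(3) by metis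
    have "ok (P \<inter> V)" "ok (Q \<inter> V)" using V PQ x y by (auto simp: ok_def)
    then show ?thesis using PQ(5) by (intro exI[of _ "P \<inter> V"] exI[of _ "Q \<inter> V"]) auto
  qed
  define next_pair where "next_pair p q \<longleftrightarrow>
      fst q \<inter> snd q = {} \<and> fst q \<subseteq> snd p \<and> snd q \<subseteq> snd p" for p q :: "'a set \<times> 'a set"
  have "\<exists>p. \<forall>n::nat. (ok (fst (p n)) \<and> ok (snd (p n))) \<and> next_pair (p n) (p (Suc n))"
  proof (rule dependent_nat_choice)
    show "\<exists>p. ok (fst p) \<and> ok (snd p)" using U by (intro exI[of _ "(U, U)"]) (auto simp: ok_def)
    show "\<exists>q. (ok (fst q) \<and> ok (snd q)) \<and> next_pair p q" if p: "ok (fst p) \<and> ok (snd p)" for p n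
    proof -
      obtain W V' where "ok W" "ok V'" "W \<subseteq> snd p" "V' \<subseteq> snd p" "W \<inter> V' = {}"
        using split[of "snd p"] p by blast
      then show ?thesis by (intro exI[of _ "(W, V')"]) (simp add: next_pair_def)
    qed
  qed
  then obtain p where p: "\<And>n. ok (fst (p n))" "\<And>n. next_pair (p n) (p (Suc n))" by blast
  have mono: "snd (p n) \<subseteq> snd (p m)" if "m \<le> n" for m n
    using lift_Suc_antimono_le[of "\<lambda>n. snd (p n)" m n] p(2) that by (auto simp: next_pair_def)
  \<comment> \<open>Index \<open>0\<close> is skipped: nothing makes the two components of
    \<open>p 0\<close> disjoint.\<close>
  define W where "W n = fst (p (Suc n))" for n
  have disj: "W m \<inter> W n = {}" if "m < n" for m n
  proof -
    have "W n \<subseteq> snd (p n)" using p(2)[of n] by (simp add: W_def next_pair_def)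
    also have "\<dots> \<subseteq> snd (p (Suc m))" by (rule mono) (use that in simp)
    finally show ?thesis using p(2)[of m] by (auto simp: W_def next_pair_def)
  qed
  then have "disjoint_family W"
    unfolding disjoint_family_on_def by (metis inf_commute nat_neq_iff)
  then show ?thesis using that[of W] p(1) by (auto simp: W_def ok_def)
qed

section \<open>Bump functions with small image\<close>

definition ball_supported_in :: "'a::topological_space set \<Rightarrow> ('a \<Rightarrow>\<^sub>C 'e::real_normed_vector) set" where
  "ball_supported_in U = {f :: 'a \<Rightarrow>\<^sub>C 'e. \<forall>x. norm (f x) \<le> 1 \<and> (x \<notin> U \<longrightarrow> f x = 0)}"

lemma ball_supported_in_mono: "U \<subseteq> V \<Longrightarrow> ball_supported_in U \<subseteq> ball_supported_in V"
  by (auto simp: ball_supported_in_def)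

text \<open>A Urysohn function is only known to be \<open>1\<close> at the chosen point; doubling it
  and truncating at \<open>1\<close> creates an open plateau.\<close>

lemma bump_exists:
  fixes U :: "'a::t2_space set" and e :: "'e::real_normed_vector"
  assumes comp: "compact (UNIV :: 'a set)" and U: "open U" "U \<noteq> {}" and e: "norm e \<le> 1"
  obtains f :: "'a \<Rightarrow>\<^sub>C 'e" and W where "f \<in> ball_supported_in U" "open W" "W \<noteq> {}" "W \<subseteq> U"
    "\<And>x. x \<in> W \<Longrightarrow> f x = e"
proof -
  obtain p where p: "p \<in> U" using U by blast
  have "Hausdorff_space (euclidean :: 'a topology)"
    unfolding Hausdorff_space_def disjnt_def using hausdorff by simp blast
  then have "normal_space (euclidean :: 'a topology)"
    using comp by (intro compact_Hausdorff_or_regular_imp_normal_space) (simp_all add: compact_space_def)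
  then obtain g :: "'a \<Rightarrow> real" where g: "continuous_map euclidean (top_of_set {0..1}) g"
      "g ` (- U) \<subseteq> {0}" "g ` {p} \<subseteq> {1}"
    using Urysohn_lemma[of euclidean "- U" "{p}" 0 1] U(1) p by (auto simp: closed_Compl disjnt_def)
  have cont: "continuous_on UNIV g" and range: "\<And>x. 0 \<le> g x \<and> g x \<le> 1"
    using g(1) by (auto simp: continuous_map_in_subtopology)
  define h where "h x = min 1 (2 * g x) *\<^sub>R e" for x
  have h_le: "norm (h x) \<le> 1" for x
    using range[of x] e mult_mono[of "min 1 (2 * g x)" 1 "norm e" 1] by (auto simp: h_def)
  have "h \<in> bcontfun"
    by (rule bcontfun_normI[OF _ h_le]) (auto simp: h_def intro!: continuous_intros cont)
  then have app: "apply_bcontfun (Bcontfun h) = h" by (rule Bcontfun_inverse)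
  define W where "W = {x. 1/2 < g x}"
  show ?thesis
  proof (rule that[of "Bcontfun h" W])
    show "Bcontfun h \<in> ball_supported_in U"
      using h_le g(2) by (auto simp: ball_supported_in_def app h_def)
    show "open W" unfolding W_def by (intro open_Collect_less continuous_intros cont)
    show "W \<noteq> {}" using g(3) by (auto simp: W_def intro!: exI[of _ p])
    show "W \<subseteq> U" using g(2) by (force simp: W_def)
    show "Bcontfun h x = e" if "x \<in> W" for x using that by (auto simp: app h_def W_def)
  qed
qed

text \<open>The plateau \<open>W\<close> is recorded so that bumps can be nested: a further bump
  supported in \<open>W\<close> is added where \<open>f\<close> already equals \<open>e\<close>, so
  the values on the inner plateaus add up.\<close>

definition small_bumps ::
  "(('a::topological_space \<Rightarrow>\<^sub>C 'e::real_normed_vector) \<Rightarrow> 'b::topological_space \<Rightarrow>\<^sub>C 'f::real_normed_vector)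
     \<Rightarrow> 'e \<Rightarrow> 'a set \<Rightarrow> real \<Rightarrow> 'b set \<Rightarrow> bool" where
  "small_bumps T e U \<epsilon> L \<longleftrightarrow>
     (\<exists>f :: 'a \<Rightarrow>\<^sub>C 'e. f \<in> ball_supported_in U \<and> (\<exists>W. open W \<and> W \<noteq> {} \<and> W \<subseteq> U \<and> (\<forall>x\<in>W. f x = e) \<and>
        (\<forall>y\<in>L. norm (T f y) \<le> \<epsilon>)))"

lemma small_bumps_mono:
  assumes "small_bumps T e V \<epsilon> L" and "V \<subseteq> U"
  shows "small_bumps T e U \<epsilon> L"
  using assms(1) subset_trans[OF _ assms(2)] subsetD[OF ball_supported_in_mono[OF assms(2)]]
  unfolding small_bumps_def by meson

lemma closed_norm_ge: "closed {y. \<delta> \<le> norm (apply_bcontfun f y)}"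
  by (intro closed_Collect_le continuous_intros) auto

text \<open>Average \<open>N\<close> bumps \<open>g\<^sub>1, \<dots>, g\<^sub>N\<close> with shrinking supports, each \<open>g\<^sub>i\<close> chosen so that \<open>T g\<^sub>i\<close> is small
  on the closed set where some earlier \<open>T g\<^sub>j\<close> was large. At every point at most one of the
  \<open>T g\<^sub>i\<close> is then large, while the average still equals \<open>e\<close> on the innermost plateau.\<close>

lemma small_bumps_average:
  fixes T :: "('a::topological_space \<Rightarrow>\<^sub>C 'e::real_normed_vector) \<Rightarrow> 'b::topological_space \<Rightarrow>\<^sub>C 'f::real_normed_vector"
  assumes T: "bounded_linear T" and U: "open U" "U \<noteq> {}" and "\<eta> > 0" and "closed L"
    and near: "\<And>f y. f \<in> ball_supported_in U \<Longrightarrow> y \<in> L \<inter> D \<Longrightarrow> norm (T f y) < \<eta>"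
    and away: "\<And>A V. closed A \<Longrightarrow> A \<inter> D = {} \<Longrightarrow> open V \<Longrightarrow> V \<noteq> {} \<Longrightarrow> small_bumps T e V \<eta> A"
  shows "small_bumps T e U (2 * \<eta>) L"
proof -
  interpret T: bounded_linear T by (rule T)
  obtain B where B: "\<And>g. norm (T g) \<le> norm g * B" "B > 0" using T.pos_bounded by blast
  \<comment> \<open>Here \<open>s\<close> is the sum of \<open>n\<close> nested bumps,
    \<open>W\<close> the innermost plateau, and \<open>A\<close> contains the points of
    \<open>L\<close> where some summand has a large image. The extra \<open>B\<close> pays for the
    single large summand at such a point.\<close>
  have partial_sums: "\<exists>A (s :: 'a \<Rightarrow>\<^sub>C 'e) W. closed A \<and> A \<inter> D = {} \<and> open W \<and> W \<noteq> {} \<and> W \<subseteq> U \<and>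
      (\<forall>x. norm (apply_bcontfun s x) \<le> real n) \<and> (\<forall>x. x \<notin> U \<longrightarrow> s x = 0) \<and> (\<forall>x\<in>W. s x = real n *\<^sub>R e) \<and>
      (\<forall>y\<in>L - A. norm (T s y) \<le> real n * \<eta>) \<and> (\<forall>y\<in>L. norm (T s y) \<le> real n * \<eta> + B)" for n
  proof (induction n)
    case 0
    show ?case
      by (intro exI[of _ "{}"] exI[of _ 0] exI[of _ U]) (use U B(2) in \<open>simp add: T.zero\<close>)
  next
    case (Suc n)
    then obtain A W and s :: "'a \<Rightarrow>\<^sub>C 'e" where A: "closed A" "A \<inter> D = {}" and W: "open W" "W \<noteq> {}" "W \<subseteq> U"
      and s: "\<And>x. norm (s x) \<le> real n" "\<And>x. x \<notin> U \<Longrightarrow> s x = 0" "\<And>x. x \<in> W \<Longrightarrow> s x = real n *\<^sub>R e"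
      and Ts: "\<And>y. y \<in> L - A \<Longrightarrow> norm (T s y) \<le> real n * \<eta>"
        "\<And>y. y \<in> L \<Longrightarrow> norm (T s y) \<le> real n * \<eta> + B"
      by blast
    obtain W' and g :: "'a \<Rightarrow>\<^sub>C 'e" where g: "g \<in> ball_supported_in W" and W': "open W'" "W' \<noteq> {}" "W' \<subseteq> W"
      and ge: "\<And>x. x \<in> W' \<Longrightarrow> g x = e" and Tg: "\<And>y. y \<in> A \<Longrightarrow> norm (T g y) \<le> \<eta>"
      using away[OF A W(1,2)] unfolding small_bumps_def by blast
    have gU: "g \<in> ball_supported_in U" using g ball_supported_in_mono[OF W(3)] by blast
    have g1: "norm (g x) \<le> 1" for x using g by (simp add: ball_supported_in_def)
    \<comment> \<open>The non-strict inequality keeps the set closed; it still misses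
      \<open>D\<close> because \<open>near\<close> is strict.\<close>
    define A' where "A' = A \<union> (L \<inter> {y. \<eta> \<le> norm (T g y)})"
    have TgB: "norm (T g y) \<le> B" for y
    proof -
      have "norm (T g y) \<le> norm (T g)" by (rule norm_bounded)
      also have "\<dots> \<le> norm g * B" by (rule B)
      also have "\<dots> \<le> 1 * B" by (intro mult_right_mono norm_bound g1) (use B in simp)
      finally show ?thesis by simp
    qed
    have tri: "norm (T (s + g) y) \<le> norm (T s y) + norm (T g y)" for y
      by (simp add: T.add norm_triangle_ineq)
    show ?case
    proof (intro exI conjI)
      show "closed A'" unfolding A'_def by (intro closed_Un closed_Int A \<open>closed L\<close> closed_norm_ge)
      show "A' \<inter> D = {}" using near[OF gU] A(2) by (fastforce simp: A'_def)
      show "open W'" "W' \<noteq> {}" "W' \<subseteq> U" using W W' by auto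
      show "\<forall>x. norm ((s + g) x) \<le> real (Suc n)"
        using s(1) g1 by (auto intro!: norm_triangle_le simp: add.commute add_mono)
      show "\<forall>x. x \<notin> U \<longrightarrow> (s + g) x = 0" using s(2) gU by (simp add: ball_supported_in_def)
      show "\<forall>x\<in>W'. (s + g) x = real (Suc n) *\<^sub>R e"
        using s(3) ge W'(3) by (auto simp: algebra_simps)
      show "\<forall>y\<in>L - A'. norm (T (s + g) y) \<le> real (Suc n) * \<eta>"
      proof
        fix y assume "y \<in> L - A'"
        then have "norm (T s y) \<le> real n * \<eta>" "norm (T g y) \<le> \<eta>" using Ts(1) by (auto simp: A'_def)
        then show "norm (T (s + g) y) \<le> real (Suc n) * \<eta>" using tri[of y] by (simp add: algebra_simps)
      qed
      show "\<forall>y\<in>L. norm (T (s + g) y) \<le> real (Suc n) * \<eta> + B"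
      proof
        fix y assume y: "y \<in> L"
        show "norm (T (s + g) y) \<le> real (Suc n) * \<eta> + B"
        \<comment> \<open>On \<open>A\<close> the new image is small by the choice of
          \<open>g\<close>; off \<open>A\<close> the old sum has no excess, so the new image may
          cost \<open>B\<close>.\<close>
        proof (cases "y \<in> A")
          case True
          then show ?thesis using Ts(2)[OF y] Tg[of y] tri[of y] by (simp add: algebra_simps)
        next
          case False
          then have "norm (T s y) \<le> real n * \<eta>" using Ts(1) y by blast
          then show ?thesis using TgB[of y] tri[of y] \<open>\<eta> > 0\<close> by (simp add: algebra_simps)
        qed
      qed
    qed
  qed
  \<comment> \<open>For \<open>B \<le> N * \<eta>\<close>, dividing \<open>N * \<eta> + B\<close> by
    \<open>N\<close> leaves at most \<open>2 * \<eta>\<close>.\<close>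
  obtain N :: nat where N: "B / \<eta> < real N" using reals_Archimedean2 by blast
  moreover have "0 < B / \<eta>" using B(2) \<open>\<eta> > 0\<close> by simp
  ultimately have N0: "real N > 0" by linarith
  have NB: "B \<le> real N * \<eta>" using N \<open>\<eta> > 0\<close> by (simp add: field_simps)
  obtain W and s :: "'a \<Rightarrow>\<^sub>C 'e" where W: "open W" "W \<noteq> {}" "W \<subseteq> U"
    and s: "\<And>x. norm (s x) \<le> real N" "\<And>x. x \<notin> U \<Longrightarrow> s x = 0" "\<And>x. x \<in> W \<Longrightarrow> s x = real N *\<^sub>R e"
    and Ts: "\<And>y. y \<in> L \<Longrightarrow> norm (T s y) \<le> real N * \<eta> + B"
    using partial_sums[of N] by blast
  let ?f = "(1 / real N) *\<^sub>R s"
  show ?thesis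
    unfolding small_bumps_def
  proof (intro exI conjI)
    show "?f \<in> ball_supported_in U"
      using s(1,2) N0 by (auto simp: ball_supported_in_def field_simps)
    show "open W" "W \<noteq> {}" "W \<subseteq> U" by fact+
    show "\<forall>x\<in>W. ?f x = e" using s(3) N0 by simp
    show "\<forall>y\<in>L. norm (T ?f y) \<le> 2 * \<eta>"
    proof
      fix y assume "y \<in> L"
      then have "norm (T s y) \<le> 2 * \<eta> * real N" using Ts[of y] NB by (simp add: algebra_simps)
      then show "norm (T ?f y) \<le> 2 * \<eta>" using N0 by (simp add: T.scaleR field_simps)
    qed
  qed
qed

text \<open>As the domain is perfect, an open set contains infinitely many disjoint open sets. If
  each supported a function with image at least \<open>\<epsilon>\<close> at \<open>y\<close>, these
  disjointly supported functions would contradict \<open>point_bounded_image\<close>. The points of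
  \<open>F\<close> are treated in turn, since smallness passes to smaller open sets.\<close>

lemma bounded_near_point:
  fixes T :: "('a::{t2_space, perfect_space} \<Rightarrow>\<^sub>C 'e::real_normed_vector) \<Rightarrow> 'b::topological_space \<Rightarrow>\<^sub>C 'f::banach"
  assumes cotype: "nontrivial_cotype TYPE('f)" and T: "bounded_linear T" and "\<epsilon> > 0"
    and U: "open U" "U \<noteq> {}" and "finite F"
  obtains V where "open V" "V \<noteq> {}" "V \<subseteq> U"
    "\<And>f y. f \<in> ball_supported_in V \<Longrightarrow> y \<in> F \<Longrightarrow> norm (T f y) < \<epsilon>"
proof -
  have "\<exists>V. open V \<and> V \<noteq> {} \<and> V \<subseteq> U \<and> (\<forall>f\<in>ball_supported_in V. \<forall>y\<in>F. norm (T f y) < \<epsilon>)"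
    using \<open>finite F\<close>
  proof (induction F)
    case empty
    show ?case using U by (intro exI[of _ U]) simp
  next
    case (insert y F)
    then obtain V where V: "open V" "V \<noteq> {}" "V \<subseteq> U"
      and F: "\<And>f y. f \<in> ball_supported_in V \<Longrightarrow> y \<in> F \<Longrightarrow> norm (T f y) < \<epsilon>" by blast
    obtain W :: "nat \<Rightarrow> 'a set" where W: "\<And>n. open (W n)" "\<And>n. W n \<subseteq> V" "\<And>n. UNIV \<inter> W n \<noteq> {}"
        "disjoint_family W"
      using disjoint_open_sequence_meeting[of UNIV V] V by (auto simp: islimpt_UNIV)
    have "\<exists>n. \<forall>f\<in>ball_supported_in (W n). norm (T f y) < \<epsilon>"
    proof (rule ccontr)
      assume "\<not> ?thesis"
      then have "\<forall>n. \<exists>f. f \<in> ball_supported_in (W n) \<and> \<epsilon> \<le> norm (T f y)" by (auto simp: not_less)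
      then obtain f where f: "\<And>n. f n \<in> ball_supported_in (W n)" "\<And>n. \<epsilon> \<le> norm (T (f n) y)"
        by metis
      have at_most_one: "finite {n \<in> UNIV. f n x \<noteq> 0} \<and> card {n \<in> UNIV. f n x \<noteq> 0} \<le> 1" for x
      proof (rule finite_card_le_1I)
        fix m n assume "m \<in> {n \<in> UNIV. f n x \<noteq> 0}" "n \<in> {n \<in> UNIV. f n x \<noteq> 0}"
        then have "x \<in> W m" "x \<in> W n" using f(1)[of m] f(1)[of n] by (auto simp: ball_supported_in_def)
        then show "m = n" using W(4) unfolding disjoint_family_on_def by (metis UNIV_I disjoint_iff)
      qed
      have le1: "norm (f n x) \<le> 1" for n x using f(1)[of n] by (simp add: ball_supported_in_def)
      obtain k' where "finite {n \<in> UNIV. \<epsilon> \<le> norm (T (f n) y)}"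
        using point_bounded_image[OF cotype T \<open>\<epsilon> > 0\<close>, of UNIV f 1] le1 at_most_one by blast
      then show False using f(2) by simp
    qed
    then obtain n where n: "\<And>f. f \<in> ball_supported_in (W n) \<Longrightarrow> norm (T f y) < \<epsilon>" by blast
    show ?case
    proof (intro exI[of _ "W n"] conjI ballI)
      show "open (W n)" "W n \<noteq> {}" "W n \<subseteq> U" using W(1-3)[of n] V(3) by auto
      show "norm (T f z) < \<epsilon>" if "f \<in> ball_supported_in (W n)" "z \<in> insert y F" for f z
        using that n F ball_supported_in_mono[OF W(2)[of n]] by blast
    qed
  qed
  then obtain V where "open V" "V \<noteq> {}" "V \<subseteq> U"
      "\<forall>f\<in>ball_supported_in V. \<forall>y\<in>F. norm (T f y) < \<epsilon>" by blast
  then show ?thesis by (intro that[of V]) simp_all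
qed

section \<open>The perfect kernel\<close>

lemma cb_derive_euclidean: "cb_derive euclidean S = {x \<in> S. x islimpt S}"
proof -
  have "euclidean derived_set_of S = {x. x islimpt S}"
    unfolding derived_set_of_def islimpt_def by (simp, meson)
  then show ?thesis unfolding cb_derive_def derived_set_of_subtopology by auto
qed

lemma closed_cb_derive:
  fixes S :: "'a::t1_space set"
  assumes "closed S"
  shows "closed (cb_derive euclidean S)"
proof -
  have "\<exists>V. open V \<and> x \<in> V \<and> V \<subseteq> - cb_derive euclidean S" if x: "x \<in> S" "\<not> x islimpt S" for x
  proof -
    obtain V where V: "open V" "x \<in> V" "\<And>y. y \<in> S \<Longrightarrow> y \<in> V \<Longrightarrow> y = x"
      using x(2) unfolding islimpt_def by blast
    have "V \<subseteq> - cb_derive euclidean S"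
    proof
      fix z assume "z \<in> V"
      show "z \<in> - cb_derive euclidean S"
        using V(3)[of z] \<open>z \<in> V\<close> x by (auto simp: cb_derive_euclidean)
    qed
    then show ?thesis using V by blast
  qed
  moreover have "\<exists>V. open V \<and> x \<in> V \<and> V \<subseteq> - cb_derive euclidean S" if "x \<notin> S" for x
    using that assms by (intro exI[of _ "- S"]) (auto simp: cb_derive_euclidean)
  ultimately have "open (- cb_derive euclidean S)"
    by (subst open_subopen) (auto simp: cb_derive_euclidean)
  then show ?thesis by (simp add: open_closed)
qed

lemma closed_cb_derivative:
  fixes r :: "'o rel"
  assumes wo: "Well_order r"
  shows "closed (cb_derivative r (euclidean :: 'a::t1_space topology) \<alpha>)"
proof (induction \<alpha> rule: wo_rel.well_order_induct[of r])
  case 1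
  then show ?case using wo by (simp add: wo_rel_def)
next
  case (2 \<alpha>)
  then have IH: "closed (cb_derivative r (euclidean :: 'a topology) \<beta>)" if "\<beta> \<in> underS r \<alpha>" for \<beta>
    using that by (auto simp: underS_def)
  consider (zero) "underS r \<alpha> = {}" | (succ) \<beta> where "ord_pred r \<beta> \<alpha>"
    | (limit) "underS r \<alpha> \<noteq> {}" "\<nexists>\<beta>. ord_pred r \<beta> \<alpha>" by blast
  then show ?case
  proof cases
    case zero
    then show ?thesis using cb_derivative_zero[OF wo zero, of "euclidean :: 'a topology"] by simp
  next
    case succ
    then show ?thesis
      using cb_derivative_succ[OF wo succ] IH closed_cb_derive by (metis ord_pred_def)
  next
    case limit
    then show ?thesis using cb_derivative_limit[OF wo limit, of "euclidean :: 'a topology"] IH by (simp add: closed_INT)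
  qed
qed

lemma cb_derivative_antimono:
  assumes wo: "Well_order r" and "(\<alpha>, \<beta>) \<in> r"
  shows "cb_derivative r X \<beta> \<subseteq> cb_derivative r X \<alpha>"
proof (cases "\<alpha> = \<beta>")
  case False
  then show ?thesis
    using cb_derivative_decreasing[OF wo, of \<alpha> \<beta> X] cb_derive_subset[of X "cb_derivative r X \<alpha>"] assms(2)
    by (auto simp: underS_def)
qed simp

text \<open>The derivative at a limit is a decreasing intersection of closed sets, so by compactness
  finitely many indices suffice, and then the largest of them does.\<close>

lemma compact_disjoint_cb_derivative_limit:
  fixes L :: "'a::t2_space set" and r :: "'o rel"
  assumes wo: "Well_order r" and limit: "underS r \<alpha> \<noteq> {}" "\<nexists>\<beta>. ord_pred r \<beta> \<alpha>"
    and L: "compact L" "L \<inter> cb_derivative r euclidean \<alpha> = {}"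
  obtains \<beta> where "\<beta> \<in> underS r \<alpha>" "L \<inter> cb_derivative r euclidean \<beta> = {}"
proof -
  let ?D = "cb_derivative r (euclidean :: 'a topology)"
  interpret R: wo_rel r using wo by (simp add: wo_rel_def)
  have "L \<inter> (\<Inter>\<beta>\<in>underS r \<alpha>. ?D \<beta>) = {}"
    using cb_derivative_limit[OF wo limit, of "euclidean :: 'a topology"] L(2) by simp
  then obtain I where I: "finite I" "I \<subseteq> underS r \<alpha>" "L \<inter> (\<Inter>\<beta>\<in>I. ?D \<beta>) = {}"
    using compact_imp_fip_image[OF L(1), of "underS r \<alpha>" ?D] closed_cb_derivative[OF wo] by metis
  have "\<exists>\<beta>\<in>underS r \<alpha>. ?D \<beta> \<subseteq> (\<Inter>\<gamma>\<in>I. ?D \<gamma>)"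
    using I(1,2)
  proof (induction I)
    case empty
    then show ?case using limit(1) by auto
  next
    case (insert \<gamma> I)
    then obtain \<beta> where \<beta>: "\<beta> \<in> underS r \<alpha>" "?D \<beta> \<subseteq> (\<Inter>\<gamma>\<in>I. ?D \<gamma>)" by auto
    have "\<beta> \<in> Field r" "\<gamma> \<in> Field r" using \<beta>(1) insert.prems by (auto simp: underS_def Field_def)
    then have "(\<beta>, \<gamma>) \<in> r \<or> (\<gamma>, \<beta>) \<in> r" using R.TOTALS by blast
    then show ?case
    proof
      assume "(\<beta>, \<gamma>) \<in> r"
      then have "?D \<gamma> \<subseteq> ?D \<beta>" by (rule cb_derivative_antimono[OF wo])
      then have "?D \<gamma> \<subseteq> (\<Inter>\<gamma>\<in>insert \<gamma> I. ?D \<gamma>)" using \<beta>(2) by (metis INF_insert inf.absorb1 order_refl order_trans)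
      then show ?thesis using insert.prems by (intro bexI[of _ \<gamma>]) simp_all
    next
      assume "(\<gamma>, \<beta>) \<in> r"
      then have "?D \<beta> \<subseteq> ?D \<gamma>" by (rule cb_derivative_antimono[OF wo])
      then have "?D \<beta> \<subseteq> (\<Inter>\<gamma>\<in>insert \<gamma> I. ?D \<gamma>)" using \<beta>(2) by simp
      then show ?thesis using \<beta>(1) by (intro bexI[of _ \<beta>]) simp_all
    qed
  qed
  then obtain \<beta> where "\<beta> \<in> underS r \<alpha>" "?D \<beta> \<subseteq> (\<Inter>\<gamma>\<in>I. ?D \<gamma>)" ..
  then show ?thesis using I(3) by (intro that[of \<beta>]) auto
qed

section \<open>Small images off the derivatives, large images on the kernel\<close>

lemma small_bumps_off_cb_derivative:
  fixes T :: "('a::{t2_space, perfect_space} \<Rightarrow>\<^sub>C 'e::real_normed_vector) \<Rightarrow> 'b::t2_space \<Rightarrow>\<^sub>C 'f::banach"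
    and r :: "'o rel"
  assumes comp: "compact (UNIV :: 'a set)" "compact (UNIV :: 'b set)"
    and cotype: "nontrivial_cotype TYPE('f)" and T: "bounded_linear T" and e: "norm e \<le> 1"
    and wo: "Well_order r"
    and L: "closed L" "L \<inter> cb_derivative r euclidean \<alpha> = {}"
    and "open U" "U \<noteq> {}" "\<epsilon> > 0"
  shows "small_bumps T e U \<epsilon> L"
  using L \<open>open U\<close> \<open>U \<noteq> {}\<close> \<open>\<epsilon> > 0\<close>
proof (induction \<alpha> arbitrary: L U \<epsilon> rule: wo_rel.well_order_induct[of r])
  case 1
  then show ?case using wo by (simp add: wo_rel_def)
next
  case (2 \<alpha>)
  note L = \<open>closed L\<close> \<open>L \<inter> cb_derivative r euclidean \<alpha> = {}\<close>
  note U = \<open>open U\<close> \<open>U \<noteq> {}\<close>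
  have IH: "small_bumps T e V \<epsilon> A"
    if "\<beta> \<in> underS r \<alpha>" "closed A" "A \<inter> cb_derivative r euclidean \<beta> = {}" "open V" "V \<noteq> {}" "\<epsilon> > 0"
    for \<beta> A V \<epsilon>
    using 2(1)[rule_format, of \<beta> A V \<epsilon>] that by (auto simp: underS_def)
  consider (zero) "underS r \<alpha> = {}" | (succ) \<beta> where "ord_pred r \<beta> \<alpha>"
    | (limit) "underS r \<alpha> \<noteq> {}" "\<nexists>\<beta>. ord_pred r \<beta> \<alpha>" by blast
  then show ?case
  proof cases
    case zero
    \<comment> \<open>The derivative at stage \<open>0\<close> is the whole space, so any bump will
      do.\<close>
    then have "L = {}" using L(2) cb_derivative_zero[OF wo zero, of "euclidean :: 'b topology"] by simp
    obtain f W where "f \<in> ball_supported_in U" "open W" "W \<noteq> {}" "W \<subseteq> U" "\<And>x. x \<in> W \<Longrightarrow> f x = e"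
      using bump_exists[OF comp(1) U e] by blast
    then show ?thesis using \<open>L = {}\<close> unfolding small_bumps_def by blast
  next
    case succ
    let ?D = "cb_derivative r (euclidean :: 'b topology) \<beta>"
    have \<beta>: "\<beta> \<in> underS r \<alpha>" using succ by (simp add: ord_pred_def)
    \<comment> \<open>An accumulation point of an infinite \<open>L \<inter> ?D\<close> would lie in
      \<open>L\<close> and in the next derivative.\<close>
    have "finite (L \<inter> ?D)"
    proof (rule ccontr)
      assume "infinite (L \<inter> ?D)"
      then obtain y where y: "y islimpt (L \<inter> ?D)"
        using Heine_Borel_imp_Bolzano_Weierstrass[OF comp(2)] by blast
      have "closed (L \<inter> ?D)" using L(1) closed_cb_derivative[OF wo] by (rule closed_Int)
      then have "y \<in> L \<inter> ?D" using y closed_limpt by blast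
      moreover have "y islimpt ?D" using y islimpt_subset by blast
      ultimately have "y \<in> L \<inter> cb_derivative r euclidean \<alpha>"
        using cb_derivative_succ[OF wo succ, of "euclidean :: 'b topology"] by (simp add: cb_derive_euclidean)
      then show False using L(2) by blast
    qed
    \<comment> \<open>The bound is halved because averaging doubles it.\<close>
    moreover have "\<epsilon> / 2 > 0" using \<open>\<epsilon> > 0\<close> by simp
    ultimately obtain V where V: "open V" "V \<noteq> {}" "V \<subseteq> U"
      and near: "\<And>f y. f \<in> ball_supported_in V \<Longrightarrow> y \<in> L \<inter> ?D \<Longrightarrow> norm (T f y) < \<epsilon> / 2"
      using bounded_near_point[OF cotype T _ U] by blast
    have "small_bumps T e V (2 * (\<epsilon> / 2)) L"
      by (rule small_bumps_average[OF T V(1,2) \<open>\<epsilon> / 2 > 0\<close> L(1), where D = ?D])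
        (fact near, rule IH[OF \<beta> _ _ _ _ \<open>\<epsilon> / 2 > 0\<close>])
    then show ?thesis using small_bumps_mono V(3) by simp
  next
    case limit
    have "compact L" using comp(2) L(1) compact_Int_closed[of UNIV L] by simp
    then obtain \<beta> where "\<beta> \<in> underS r \<alpha>" "L \<inter> cb_derivative r euclidean \<beta> = {}"
      using compact_disjoint_cb_derivative_limit[OF wo limit _ L(2)] by blast
    then show ?thesis using IH L(1) U \<open>\<epsilon> > 0\<close> by blast
  qed
qed

text \<open>Here \<open>B\<close> bounds the inverse of \<open>T\<close>. If all images stayed below
  \<open>\<eta>\<close> on the kernel, averaging over the whole space would give an \<open>f\<close>
  attaining the unit vector \<open>e\<close> with \<open>norm (T f) \<le> 2 * \<eta>\<close>, hence
  \<open>norm f < 1\<close>.\<close>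

lemma large_at_perfect_kernel:
  fixes T :: "('a::{t2_space, perfect_space} \<Rightarrow>\<^sub>C 'e::real_normed_vector) \<Rightarrow> 'b::t2_space \<Rightarrow>\<^sub>C 'f::banach" and e :: 'e
  assumes comp: "compact (UNIV :: 'a set)" "compact (UNIV :: 'b set)"
    and cotype: "nontrivial_cotype TYPE('f)" and T: "bounded_linear T" and e: "norm e = 1"
    and lower: "\<And>f. norm f \<le> B * norm (T f)" and \<eta>: "\<eta> > 0" "B * (2 * \<eta>) < 1"
    and U: "open U" "U \<noteq> {}" and "B \<ge> 0"
  obtains (witness) f y where "f \<in> ball_supported_in U" "y \<in> perfect_kernel euclidean" "\<eta> \<le> norm (T f y)"
proof (rule ccontr)
  assume contra: "\<not> thesis"
  have near: "norm (T f y) < \<eta>"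
    if "f \<in> ball_supported_in U" "y \<in> UNIV \<inter> perfect_kernel euclidean" for f y
    using witness[of f y] contra that by (auto simp: not_le[symmetric])
  let ?r = "|UNIV :: 'b set set|"
  have wo: "Well_order ?r" by (rule card_of_Well_order)
  obtain \<alpha> where \<alpha>: "perfect_kernel (euclidean :: 'b topology) = cb_derivative ?r euclidean \<alpha>"
    using perfect_kernel_fixpoint[of "euclidean :: 'b topology"] by (elim exE conjE that)
  have "small_bumps T e U (2 * \<eta>) UNIV"
  proof (rule small_bumps_average[OF T U \<eta>(1) closed_UNIV near])
    fix A :: "'b set" and V :: "'a set"
    assume "closed A" "A \<inter> perfect_kernel euclidean = {}" "open V" "V \<noteq> {}"
    then show "small_bumps T e V \<eta> A"
      using small_bumps_off_cb_derivative[OF comp cotype T _ wo] \<alpha> e \<eta>(1) by simp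
  qed
  then obtain f :: "'a \<Rightarrow>\<^sub>C 'e" and x where f: "f x = e" "\<And>y. norm (T f y) \<le> 2 * \<eta>"
    unfolding small_bumps_def by blast
  have "1 \<le> norm f" using norm_bounded[of f x] f(1) e by simp
  also have "\<dots> \<le> B * norm (T f)" by (rule lower)
  also have "\<dots> \<le> B * (2 * \<eta>)" by (intro mult_left_mono norm_bound f(2) \<open>B \<ge> 0\<close>)
  finally show False using \<eta>(2) by simp
qed

section \<open>Cardinal bounds\<close>

lemma card_Sup_upper:
  assumes "\<And>r. r \<in> R \<Longrightarrow> Card_order r" and "r \<in> R"
  shows "r \<le>o card_Sup R"
  using is_card_Sup_card_Sup[of R] assms by (simp add: is_card_Sup_def)

lemma Card_order_card_Sup:
  assumes "\<And>r. r \<in> R \<Longrightarrow> Card_order r"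
  shows "Card_order (card_Sup R)"
  using is_card_Sup_card_Sup[OF assms] by (simp add: is_card_Sup_def)

lemma cellularity_upper:
  "(\<And>U. U \<in> \<U> \<Longrightarrow> openin X U \<and> U \<noteq> {}) \<Longrightarrow> pairwise disjnt \<U> \<Longrightarrow> |\<U>| \<le>o cellularity X"
  unfolding cellularity_def by (rule card_Sup_upper) (auto simp: card_of_Card_order)

lemma Card_order_cellularity: "Card_order (cellularity X)"
  unfolding cellularity_def by (rule Card_order_card_Sup) (auto simp: card_of_Card_order)

lemma c_pb_upper:
  "(\<And>U. U \<in> \<U> \<Longrightarrow> openin X U) \<Longrightarrow> point_bounded X \<U> \<Longrightarrow> family_meeting \<U> A \<Longrightarrow> |\<U>| \<le>o c_pb A X"
  unfolding c_pb_def by (rule card_Sup_upper) (auto simp: card_of_Card_order)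

lemma Card_order_c_pb: "Card_order (c_pb A X)"
  unfolding c_pb_def by (rule Card_order_card_Sup) (auto simp: card_of_Card_order)

lemma infinite_Field_if_ordLeq:
  assumes "|A| \<le>o r" "infinite A" "Card_order r"
  shows "infinite (Field r)"
proof -
  have "|A| \<le>o |Field r|"
    using assms card_of_Field_ordIso ordIso_symmetric ordLeq_ordIso_trans by blast
  then show ?thesis using assms(2) card_of_ordLeq_finite by blast
qed

lemma finite_ordLeq_infinite_Field:
  assumes "finite A" "infinite (Field r)" "Card_order r"
  shows "|A| \<le>o r"
proof -
  have "Well_order r" using assms(3) by (simp add: card_order_on_def)
  moreover have "finite (Field |A| )" using assms(1) by (simp add: Field_card_of)
  ultimately show ?thesis
    using finite_ordLess_infinite[OF card_of_Well_order] assms(2) ordLess_imp_ordLeq by blast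
qed

text \<open>The members of \<open>\<U>\<close> are covered by finite subfamilies that correspond
  injectively to disjoint open subsets of \<open>A\<close>; the infinite cardinal absorbs the finite
  sizes.\<close>

lemma point_bounded_ordLeq_cellularity:
  assumes opn: "\<And>U. U \<in> \<U> \<Longrightarrow> openin X U" and pb: "point_bounded X \<U>" and meet: "family_meeting \<U> A"
    and inf: "infinite (Field (cellularity (subtopology X A)))"
  shows "|\<U>| \<le>o cellularity (subtopology X A)"
proof -
  let ?c = "cellularity (subtopology X A)"
  \<comment> \<open>Distinct maximal subfamilies with a common point in \<open>A\<close> have disjoint intersections inside \<open>A\<close>.\<close>
  define star where "star x = {U \<in> \<U>. x \<in> U}" for x
  obtain k where k: "\<And>x. x \<in> topspace X \<Longrightarrow> finite (star x) \<and> card (star x) \<le> k"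
    using pb by (auto simp: point_bounded_def star_def)
  define core where "core F = A \<inter> \<Inter>F" for F
  define M where "M = {F. F \<subseteq> \<U> \<and> finite F \<and> F \<noteq> {} \<and> core F \<noteq> {} \<and> (\<forall>x\<in>core F. star x \<subseteq> F)}"
  have subset_eq: "F = G" if "F \<in> M" "G \<in> M" "core F \<inter> core G \<noteq> {}" for F G
  proof -
    obtain x where "x \<in> core F" "x \<in> core G" using \<open>core F \<inter> core G \<noteq> {}\<close> by blast
    then have "star x \<subseteq> F" "star x \<subseteq> G" "F \<subseteq> star x" "G \<subseteq> star x"
      using that(1,2) by (auto simp: M_def core_def star_def)
    then show ?thesis by blast
  qed
  have cover: "\<exists>F\<in>M. U \<in> F" if U: "U \<in> \<U>" for U
  proof -
    have top: "x \<in> topspace X" if "x \<in> A \<inter> U" for x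
      using that U opn openin_subset by blast
    obtain x0 where "x0 \<in> A \<inter> U" using meet U by (auto simp: family_meeting_def)
    \<comment> \<open>Because star sizes are bounded, some point of \<open>A \<inter> U\<close> has
      a star of maximal size. Any point of the core of that star lies in all its members, hence by
      maximality in no others.\<close>
    then obtain x where x: "x \<in> A \<inter> U" and max: "\<And>z. z \<in> A \<inter> U \<Longrightarrow> card (star z) \<le> card (star x)"
      using ex_has_greatest_nat[of "\<lambda>x. x \<in> A \<inter> U" x0 "\<lambda>x. card (star x)" "Suc k"] k top
      by (metis less_Suc_eq_le)
    have "star z \<subseteq> star x" if z: "z \<in> core (star x)" for z
    proof -
      have "U \<in> star x" using x U by (simp add: star_def)
      then have zU: "z \<in> A \<inter> U" using z by (auto simp: core_def)
      moreover have sub: "star x \<subseteq> star z" using z by (auto simp: core_def star_def)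
      ultimately have "star x = star z"
        using max[OF zU] k[OF top[OF zU]] card_seteq by blast
      then show ?thesis by simp
    qed
    then have "star x \<in> M"
      using x U k[OF top[OF x]] by (auto simp: M_def core_def star_def)
    then show ?thesis using x U by (intro bexI[of _ "star x"]) (simp_all add: star_def)
  qed
  have "|core ` M| \<le>o ?c"
  proof (rule cellularity_upper)
    show "openin (subtopology X A) V \<and> V \<noteq> {}" if "V \<in> core ` M" for V
    proof -
      obtain F where F: "F \<in> M" "V = core F" using \<open>V \<in> core ` M\<close> by blast
      then have "openin X (\<Inter>F)" using opn by (intro openin_Inter) (auto simp: M_def)
      then show ?thesis using F by (auto simp: M_def core_def openin_subtopology_Int2)
    qed
    show "pairwise disjnt (core ` M)"
      using subset_eq unfolding pairwise_def disjnt_def by blast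
  qed
  moreover have "inj_on core M"
    using subset_eq by (intro inj_onI) (auto simp: M_def)
  then have "|M| =o |core ` M|"
    using card_of_ordIsoI[of core M "core ` M"] by (simp add: bij_betw_def)
  ultimately have "|M| \<le>o ?c" using ordIso_ordLeq_trans by blast
  then have "|\<Union>F\<in>M. F| \<le>o ?c"
    using inf Card_order_cellularity finite_ordLeq_infinite_Field
    by (intro card_of_UNION_ordLeq_infinite_Field ballI) (auto simp: M_def)
  moreover have "|\<U>| \<le>o |\<Union>F\<in>M. F|" using cover by (intro card_of_mono1) blast
  ultimately show ?thesis using ordLeq_transitive by blast
qed

lemma infinite_range_disjoint:
  assumes "disjoint_family W" "\<And>n::nat. W n \<noteq> {}"
  shows "infinite (range W)"
proof -
  have "inj W" using assms by (intro injI) (metis UNIV_I disjoint_family_on_def inf.idem)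
  then show ?thesis by (simp add: range_inj_infinite)
qed

lemma pairwise_disjnt_range: "disjoint_family W \<Longrightarrow> pairwise disjnt (range W)"
  unfolding pairwise_def disjnt_def disjoint_family_on_def by (metis UNIV_I imageE)

text \<open>The superset \<open>B\<close> allows one statement to serve both the kernel and the
  whole space.\<close>

lemma infinite_cellularity:
  fixes A B :: "'a::t2_space set"
  assumes A: "A \<noteq> {}" "\<And>x. x \<in> A \<Longrightarrow> x islimpt A" and "A \<subseteq> B"
  shows "infinite (Field (cellularity (top_of_set B)))"
proof -
  obtain W :: "nat \<Rightarrow> 'a set" where W: "\<And>n. open (W n)" "\<And>n. A \<inter> W n \<noteq> {}" "disjoint_family W"
    using disjoint_open_sequence_meeting[OF A(2), of UNIV] A(1) by auto
  let ?V = "\<lambda>n. B \<inter> W n"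
  have ne: "?V n \<noteq> {}" for n using W(2)[of n] \<open>A \<subseteq> B\<close> by blast
  have V: "disjoint_family ?V" using W(3) by (auto simp: disjoint_family_on_def)
  have "|range ?V| \<le>o cellularity (top_of_set B)"
    by (rule cellularity_upper) (use W(1) ne pairwise_disjnt_range[OF V] in auto)
  then show ?thesis
    using infinite_Field_if_ordLeq infinite_range_disjoint[OF V ne] Card_order_cellularity by blast
qed

lemma infinite_c_pb:
  fixes A :: "'a::t2_space set"
  assumes A: "A \<noteq> {}" "\<And>x. x \<in> A \<Longrightarrow> x islimpt A"
  shows "infinite (Field (c_pb A euclidean))"
proof -
  obtain W :: "nat \<Rightarrow> 'a set" where W: "\<And>n. open (W n)" "\<And>n. A \<inter> W n \<noteq> {}" "disjoint_family W"
    using disjoint_open_sequence_meeting[OF A(2), of UNIV] A(1) by auto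
  have "finite {U \<in> range W. x \<in> U} \<and> card {U \<in> range W. x \<in> U} \<le> 1" for x
  proof (rule finite_card_le_1I, rule ccontr)
    fix U V assume UV: "U \<in> {U \<in> range W. x \<in> U}" "V \<in> {U \<in> range W. x \<in> U}" "U \<noteq> V"
    then have "U \<in> range W" "V \<in> range W" "x \<in> U \<inter> V" by auto
    then show False
      using pairwise_disjnt_range[OF W(3)] UV(3) by (auto simp: pairwise_def disjnt_def)
  qed
  then have "point_bounded euclidean (range W)"
    using W(2) by (auto simp: point_bounded_def)
  then have "|range W| \<le>o c_pb A euclidean"
    by (rule c_pb_upper[rotated]) (use W(1,2) in \<open>auto simp: family_meeting_def\<close>)
  moreover have "infinite (range W)" using W(2) by (intro infinite_range_disjoint W(3)) blast
  ultimately show ?thesis using infinite_Field_if_ordLeq Card_order_c_pb by blast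
qed

text \<open>\<open>c_pb\<close> counts sets, whereas \<open>V\<close> may take the same value at
  several indices. A point of that value bounds the number of these indices, and an infinite
  cardinal absorbs finite fibres.\<close>

lemma indexed_family_ordLeq_c_pb:
  assumes V: "\<And>i. i \<in> I \<Longrightarrow> openin X (V i)" "\<And>i. i \<in> I \<Longrightarrow> A \<inter> V i \<noteq> {}"
    and k: "\<And>x. finite {i \<in> I. x \<in> V i} \<and> card {i \<in> I. x \<in> V i} \<le> k"
    and inf: "infinite (Field (c_pb A X))"
  shows "|I| \<le>o c_pb A X"
proof -
  have eq: "{U \<in> V ` I. x \<in> U} = V ` {i \<in> I. x \<in> V i}" for x by auto
  have "finite {U \<in> V ` I. x \<in> U} \<and> card {U \<in> V ` I. x \<in> U} \<le> k" for x
    unfolding eq using k[of x] card_image_le order_trans by blast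
  then have "point_bounded X (V ` I)"
    using V openin_subset unfolding point_bounded_def by blast
  then have "|V ` I| \<le>o c_pb A X"
    by (rule c_pb_upper[rotated]) (use V in \<open>auto simp: family_meeting_def\<close>)
  moreover have "finite {i \<in> I. V i = U}" if U: "U \<in> V ` I" for U
  proof -
    obtain x where "x \<in> U" using V(2) U by blast
    then show ?thesis using k[of x] by (elim conjE finite_subset[rotated]) auto
  qed
  ultimately have "|\<Union>U\<in>V ` I. {i \<in> I. V i = U}| \<le>o c_pb A X"
    using inf Card_order_c_pb finite_ordLeq_infinite_Field
    by (intro card_of_UNION_ordLeq_infinite_Field) blast+
  moreover have "I = (\<Union>U\<in>V ` I. {i \<in> I. V i = U})" by blast
  ultimately show ?thesis by simp
qed

section \<open>Transfer of disjoint families through the isomorphism\<close>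

text \<open>Bumps \<open>f U\<close> on the given sets have \<open>S\<close>-images exceeding
  \<open>\<delta>\<close> on open sets \<open>G U\<close>, point-bounded by the cotype of
  \<open>'e\<close>. Each \<open>G U\<close> supports some \<open>h U\<close> whose
  \<open>T\<close>-image is large on the kernel, and the cotype of \<open>'f\<close> bounds the
  overlaps there.\<close>

lemma disjoint_family_transfer:
  fixes T :: "('a::{t2_space, perfect_space} \<Rightarrow>\<^sub>C 'e::banach) \<Rightarrow> 'b::t2_space \<Rightarrow>\<^sub>C 'f::banach"
    and \<U> :: "'b set set"
  assumes comp: "compact (UNIV :: 'a set)" "compact (UNIV :: 'b set)"
    and nz: "(UNIV :: 'e set) \<noteq> {0}" "(UNIV :: 'f set) \<noteq> {0}"
    and cotype: "nontrivial_cotype TYPE('e)" "nontrivial_cotype TYPE('f)"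
    and T: "bounded_linear T" and S: "bounded_linear S"
    and inv: "\<And>f. S (T f) = f" "\<And>g. T (S g) = g"
    and \<U>: "\<And>U. U \<in> \<U> \<Longrightarrow> open U \<and> U \<noteq> {}" "pairwise disjnt \<U>"
  obtains V :: "'b set \<Rightarrow> 'b set" and k where "\<And>U. U \<in> \<U> \<Longrightarrow> open (V U)"
    "\<And>U. U \<in> \<U> \<Longrightarrow> perfect_kernel euclidean \<inter> V U \<noteq> {}"
    "\<And>y. finite {U \<in> \<U>. y \<in> V U} \<and> card {U \<in> \<U>. y \<in> V U} \<le> k"
proof -
  obtain B where B: "\<And>f. norm (T f) \<le> norm f * B" "B > 0"
    using bounded_linear.pos_bounded[OF T] by blast
  obtain C where C: "\<And>g. norm (S g) \<le> norm g * C" "C > 0"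
    using bounded_linear.pos_bounded[OF S] by blast
  have "\<exists>e::'x. norm e = 1" if "(UNIV :: 'x::real_normed_vector set) \<noteq> {0}"
  proof -
    have "\<exists>e::'x. e \<noteq> 0" using that by auto
    then obtain e :: 'x where "e \<noteq> 0" ..
    then show ?thesis by (intro exI[of _ "sgn e"]) (simp add: norm_sgn)
  qed
  then obtain e :: 'e and e' :: 'f where e: "norm e = 1" and e': "norm e' = 1"
    using nz by meson
  \<comment> \<open>If \<open>norm (S f) \<le> \<delta>\<close>, then
    \<open>norm f \<le> 1 / 2\<close>, although \<open>f\<close> attains the unit vector
    \<open>e'\<close>.\<close>
  define \<delta> where "\<delta> = 1 / (2 * B)"
  have "\<delta> > 0" using B(2) by (simp add: \<delta>_def)
  have "\<exists>f. f \<in> ball_supported_in U \<and> (\<exists>x. \<delta> < norm (S f x))" if U: "U \<in> \<U>" for U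
  proof -
    obtain f :: "'b \<Rightarrow>\<^sub>C 'f" and W where f: "f \<in> ball_supported_in U" "W \<noteq> {}" "\<And>x. x \<in> W \<Longrightarrow> f x = e'"
      using bump_exists[OF comp(2), of U e'] \<U>(1)[OF U] e' by (metis order_refl)
    have "\<exists>x. \<delta> < norm (S f x)"
    proof (rule ccontr)
      assume "\<not> ?thesis"
      then have "norm (S f) \<le> \<delta>" by (intro norm_bound) (simp add: not_less)
      obtain y where "f y = e'" using f(2,3) by blast
      then have "1 \<le> norm (T (S f))" using norm_bounded[of f y] e' inv(2) by simp
      also have "\<dots> \<le> norm (S f) * B" by (rule B)
      also have "\<dots> \<le> \<delta> * B" using \<open>norm (S f) \<le> \<delta>\<close> B(2) by (simp add: mult_right_mono)
      finally show False using B(2) by (simp add: \<delta>_def)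
    qed
    then show ?thesis using f(1) by blast
  qed
  then obtain f where f: "\<And>U. U \<in> \<U> \<Longrightarrow> f U \<in> ball_supported_in U"
      "\<And>U. U \<in> \<U> \<Longrightarrow> \<exists>x. \<delta> < norm (S (f U) x)"
    by metis
  have "finite {U \<in> \<U>. f U y \<noteq> 0} \<and> card {U \<in> \<U>. f U y \<noteq> 0} \<le> 1" for y
  proof (rule finite_card_le_1I, rule ccontr)
    fix U V assume UV: "U \<in> {U \<in> \<U>. f U y \<noteq> 0}" "V \<in> {U \<in> \<U>. f U y \<noteq> 0}" "U \<noteq> V"
    then have "y \<in> U" "y \<in> V" using f(1)[of U] f(1)[of V] by (auto simp: ball_supported_in_def)
    then show False using \<U>(2) UV unfolding pairwise_def disjnt_def by blast
  qed
  moreover have "norm (f U y) \<le> 1" if "U \<in> \<U>" for U y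
    using f(1)[OF that] by (simp add: ball_supported_in_def)
  ultimately obtain k where k: "\<And>x. finite {U \<in> \<U>. \<delta> \<le> norm (S (f U) x)} \<and> card {U \<in> \<U>. \<delta> \<le> norm (S (f U) x)} \<le> k"
    using point_bounded_image[OF cotype(1) S \<open>\<delta> > 0\<close>, of \<U> f 1] by blast
  define G where "G U = {x. \<delta> < norm (S (f U) x)}" for U
  have G: "open (G U)" for U
    unfolding G_def by (intro open_Collect_less continuous_intros) auto
  \<comment> \<open>As \<open>C\<close> bounds the inverse \<open>S\<close>, this makes
    \<open>C * (2 * \<eta>)\<close> equal to \<open>1 / 2\<close>.\<close>
  define \<eta> where "\<eta> = 1 / (4 * C)"
  have \<eta>: "\<eta> > 0" "C * (2 * \<eta>) < 1" using C(2) by (simp_all add: \<eta>_def)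
  have lower: "norm g \<le> C * norm (T g)" for g using C(1)[of "T g"] inv(1) by (simp add: mult.commute)
  have "\<exists>h. h \<in> ball_supported_in (G U) \<and> (\<exists>y\<in>perfect_kernel euclidean. \<eta> \<le> norm (T h y))"
    if "U \<in> \<U>" for U
    using large_at_perfect_kernel[OF comp cotype(2) T e lower \<eta> G, of U] f(2)[OF that] C(2)
    unfolding G_def by (metis (no_types, lifting) Collect_empty_eq less_imp_le)
  then obtain h where h: "\<And>U. U \<in> \<U> \<Longrightarrow> h U \<in> ball_supported_in (G U)"
      "\<And>U. U \<in> \<U> \<Longrightarrow> \<exists>y\<in>perfect_kernel euclidean. \<eta> \<le> norm (T (h U) y)"
    by metis
  have "finite {U \<in> \<U>. h U x \<noteq> 0} \<and> card {U \<in> \<U>. h U x \<noteq> 0} \<le> k" for x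
  proof -
    have sub: "{U \<in> \<U>. h U x \<noteq> 0} \<subseteq> {U \<in> \<U>. \<delta> \<le> norm (S (f U) x)}"
    proof
      fix U assume "U \<in> {U \<in> \<U>. h U x \<noteq> 0}"
      then have "U \<in> \<U>" "x \<in> G U" using h(1)[of U] by (auto simp: ball_supported_in_def)
      then show "U \<in> {U \<in> \<U>. \<delta> \<le> norm (S (f U) x)}" by (simp add: G_def)
    qed
    then show ?thesis using k[of x] card_mono[OF _ sub] finite_subset[OF sub] by auto
  qed
  moreover have "norm (h U x) \<le> 1" if "U \<in> \<U>" for U x
    using h(1)[OF that] by (simp add: ball_supported_in_def)
  moreover have "\<eta> / 2 > 0" using \<eta>(1) by simp
  ultimately obtain k' where k': "\<And>y. finite {U \<in> \<U>. \<eta> / 2 \<le> norm (T (h U) y)} \<and>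
      card {U \<in> \<U>. \<eta> / 2 \<le> norm (T (h U) y)} \<le> k'"
    using point_bounded_image[OF cotype(2) T, of "\<eta> / 2" \<U> h k] by blast
  \<comment> \<open>Lowering the threshold to \<open>\<eta> / 2\<close> permits a strict inequality,
    hence an open set, that still contains the kernel point where the norm reaches
    \<open>\<eta>\<close>.\<close>
  define V where "V U = {y. \<eta> / 2 < norm (T (h U) y)}" for U
  show ?thesis
  proof (rule that[of V k'])
    show "open (V U)" for U
      unfolding V_def by (intro open_Collect_less continuous_intros) auto
    show "perfect_kernel euclidean \<inter> V U \<noteq> {}" if "U \<in> \<U>" for U
      using h(2)[OF that] \<eta>(1) by (force simp: V_def)
    show "finite {U \<in> \<U>. y \<in> V U} \<and> card {U \<in> \<U>. y \<in> V U} \<le> k'" for y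
    proof -
      have sub: "{U \<in> \<U>. y \<in> V U} \<subseteq> {U \<in> \<U>. \<eta> / 2 \<le> norm (T (h U) y)}" by (auto simp: V_def)
      then show ?thesis using k'[of y] card_mono[OF _ sub] finite_subset[OF sub] by auto
    qed
  qed
qed

theorem corollary1p5:
  assumes "compact (UNIV :: 'k1::{t2_space, perfect_space} set)"
    and "infinite (UNIV :: 'k1::{t2_space, perfect_space} set)"
    and "compact (UNIV :: 'k2::t2_space set)"
    and "infinite (UNIV :: 'k2::t2_space set)"
    and "(UNIV :: 'e1::banach set) \<noteq> {0}"
    and "nontrivial_cotype TYPE('e1::banach)"
    and "(UNIV :: 'e2::banach set) \<noteq> {0}"
    and "nontrivial_cotype TYPE('e2::banach)"
    and "isomorphic_spaces TYPE('k1::{t2_space, perfect_space} \<Rightarrow>\<^sub>C 'e1::banach)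
           TYPE('k2::t2_space \<Rightarrow>\<^sub>C 'e2::banach)"
  shows "c_pb (perfect_kernel (euclidean :: 'k2::t2_space topology)) euclidean
           =o cellularity (euclidean :: 'k2::t2_space topology) \<and>
         cellularity (euclidean :: 'k2::t2_space topology)
           \<le>o cellularity (top_of_set (perfect_kernel (euclidean :: 'k2::t2_space topology)))"
proof -
  let ?P = "perfect_kernel (euclidean :: 'k2 topology)"
  obtain T :: "('k1 \<Rightarrow>\<^sub>C 'e1) \<Rightarrow> ('k2 \<Rightarrow>\<^sub>C 'e2)" and S
    where T: "bounded_linear T" "bounded_linear S" "\<And>f. S (T f) = f" "\<And>g. T (S g) = g"
    using isomorphic_spaces_bounded_linear[OF assms(9)] by blast
  note transfer = disjoint_family_transfer[OF assms(1,3,5,7,6,8) T]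
  have limpt: "y islimpt ?P" if "y \<in> ?P" for y
    using that cb_derive_perfect_kernel[of euclidean] unfolding cb_derive_euclidean by blast
  \<comment> \<open>Transferring the one-member family \<open>{UNIV}\<close> yields a set that meets
    \<open>?P\<close>.\<close>
  have "?P \<noteq> {}"
    using transfer[of "{UNIV}"] by (auto simp: pairwise_def)
  have inf: "infinite (Field (c_pb ?P euclidean))"
    by (rule infinite_c_pb[OF \<open>?P \<noteq> {}\<close> limpt])
  have inf_cell: "infinite (Field (cellularity (top_of_set B)))" if "?P \<subseteq> B" for B
    by (rule infinite_cellularity[OF \<open>?P \<noteq> {}\<close> limpt that])
  have cell_le: "cellularity (euclidean :: 'k2 topology) \<le>o c_pb ?P euclidean"
    unfolding cellularity_def
  proof (rule card_Sup_least)
    fix R assume "R \<in> {|\<U>| | \<U>. (\<forall>U\<in>\<U>. openin (euclidean :: 'k2 topology) U \<and> U \<noteq> {}) \<and> pairwise disjnt \<U>}"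
    then obtain \<U> :: "'k2 set set" where \<U>: "R = |\<U>|" "\<And>U. U \<in> \<U> \<Longrightarrow> open U \<and> U \<noteq> {}" "pairwise disjnt \<U>"
      by auto
    show "R \<le>o c_pb ?P euclidean"
    proof (rule transfer[OF \<U>(2,3)])
      fix V k
      assume V: "\<And>U. U \<in> \<U> \<Longrightarrow> open (V U)" "\<And>U. U \<in> \<U> \<Longrightarrow> ?P \<inter> V U \<noteq> {}"
        "\<And>y. finite {U \<in> \<U>. y \<in> V U} \<and> card {U \<in> \<U>. y \<in> V U} \<le> k"
      show ?thesis
        unfolding \<U>(1) by (rule indexed_family_ordLeq_c_pb[OF _ V(2,3) inf]) (simp_all add: V(1))
    qed
  qed (auto simp: card_of_Card_order Card_order_c_pb)
  have c_pb_le: "c_pb ?P euclidean \<le>o r"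
    if "Card_order r" and
      "\<And>\<U>. (\<And>U. U \<in> \<U> \<Longrightarrow> openin euclidean U) \<Longrightarrow> point_bounded euclidean \<U> \<Longrightarrow> family_meeting \<U> ?P \<Longrightarrow> |\<U>| \<le>o r"
    for r :: "'k2 set rel"
    unfolding c_pb_def by (rule card_Sup_least) (use that in \<open>auto simp: card_of_Card_order\<close>)
  \<comment> \<open>Combined with \<open>cell_le\<close>, this gives the second claim.\<close>
  have "c_pb ?P euclidean \<le>o cellularity (top_of_set ?P)"
    by (intro c_pb_le point_bounded_ordLeq_cellularity inf_cell Card_order_cellularity subset_refl)
  moreover have "c_pb ?P euclidean \<le>o cellularity (euclidean :: 'k2 topology)"
  proof (rule c_pb_le[OF Card_order_cellularity])
    fix \<U> :: "'k2 set set"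
    assume \<U>: "\<And>U. U \<in> \<U> \<Longrightarrow> openin euclidean U" "point_bounded euclidean \<U>" "family_meeting \<U> ?P"
    \<comment> \<open>The comparison is made inside the whole space, where meeting \<open>?P\<close>
      is weakened to being nonempty.\<close>
    have "|\<U>| \<le>o cellularity (top_of_set (UNIV :: 'k2 set))"
    proof (rule point_bounded_ordLeq_cellularity[OF \<U>(1,2)])
      show "family_meeting \<U> UNIV" using \<U>(3) by (auto simp: family_meeting_def)
      show "infinite (Field (cellularity (top_of_set (UNIV :: 'k2 set))))" by (rule inf_cell) simp
    qed
    then show "|\<U>| \<le>o cellularity (euclidean :: 'k2 topology)" by simp
  qed
  ultimately show ?thesis
    using cell_le ordIso_iff_ordLeq ordLeq_transitive by blast
qed

end
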